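(* Fix $\kappa\in(0,1/3)$. There exist $C>0$ and an integer $L_0\ge1$ such that for all $L\ge L_0$ and all $x_0\in Q_{R_L-r_L}$, on the event $E_{L,x_0}=E_{L,x_0}(\kappa)$, $$\big|\lambda_1(Q_{R_L},\xi_L)-\bar\lambda_L-\Xi_L(x_0)\big|\le C\frac{d_L}{a_L}\Big(\Big(\frac{d_L}{a_L}\Big)^{1-2\kappa}|\xi_L(x_0)-a_L|+\frac1{a_L}\Big),$$ and $$\|\varphi_{R_L}-\bar\varphi_L(\cdot-x_0)\|_{\ell^2(Q_{R_L})}\le C\frac{d_L}{a_L}\sqrt{\Big(\frac{d_L}{a_L}\Big)^{1-2\kappa}|\xi_L(x_0)-a_L|+\frac1{a_L}},$$ where $\bar\varphi_L$ is extended by $0$ outside $Q_{r_L}$.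
   Context: Fix $d\ge1$; $|x|$ Euclidean norm; $Q_a=[-a/2,a/2]^d\cap\mathbb{Z}^d$, $Q_{a,x}=x+Q_a$, $Q_a^{\neq0}=Q_a\setminus\{0\}$; $u_L\ll v_L$ means $u_L/v_L\to0$. For each $L\ge1$, $(\xi_L(x))_{x\in\mathbb{Z}^d}$ is a centred shift-stationary Gaussian field with unit variance and non-negative covariance $v_L$ with (I) $\sup_{|x|\ge\exp(\sqrt{\ln L})}v_L(x)\ln|x|\to0$; (II) there are $\mathfrak c,\mathfrak c'>0$ with $1-e^{\mathfrak c'|x|}/d_L\le v_L(x)\le1-\mathfrak c/d_L$ for all $L,x\ne0$, where $\sup_{|x|=1}v_L(x)=1-1/d_L$. $a_L$: $\mathbb{P}(\xi_L(0)>a_L)=L^{-d}$. Fix $R_L,r_L$ with $a_L\ll\ln R_L\ll a_L^2/d_L$, $\ln a_L\le\ln r_L\ll\sqrt{a_L}$. $\Delta f(x)=\sum_{|y-x|=1}(f(y)-f(x))$; Dirichlet operators act on functions extended by $0$ outside the domain. $\lambda_1(Q_{R_L},\xi_L)$ and $\varphi_{R_L}\ge0$: principal eigenvalue and $\ell^2$-normalised eigenfunction of $\Delta+\xi_L$ on $Q_{R_L}$ (Dirichlet). $\mathcal{S}_L(x)=a_L(1-v_L(x))$; $\bar\lambda_L,\bar\varphi_L\ge0$: principal eigenvalue and normalised eigenfunction of $\Delta-\mathcal{S}_L$ on $Q_{r_L}$ (Dirichlet). $\zeta_{L,x_0}(x)=\xi_L(x)-\xi_L(x_0)v_L(x-x_0)$;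 $\Phi_L(y)=\sum_{x\in Q_{r_L}^{\neq0}}\bar\varphi_L(x)^2\zeta_{L,y}(x+y)$; $\tau_L^2=\mathrm{Var}(\Phi_L(y))$; $\Xi_L=\xi_L+\Phi_L$. Standing assumptions: $d_L\ll a_L$, $\tau_L\ll a_L^{-1}(a_L/d_L)^{1/2}$. With $\theta=2d+1$: $E_{L,x_0}(\kappa)=E^1\cap E^2\cap E^3$ with $E^1=\{|\xi_L(x_0)-a_L|<\theta\}$, $E^2=\{|\zeta_{L,x_0}(x)|\le\frac1{10}\mathcal{S}_L(x-x_0)\ \forall x\in Q_{2R_L,x_0}\}$, $E^3=\bigcap_{x\in Q_{R_L,x_0}\setminus\{x_0\}}\{|\zeta_{L,x_0}(x)|/\sqrt{\mathrm{Var}[\zeta_{L,x_0}(x)]}\le(a_L/d_L)^{\kappa|x-x_0|}\sqrt{1\vee(|\xi_L(x_0)-a_L|a_L)}\}$. *)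

theory Defs
  imports "HOL-Probability.Probability"
begin

text \<open>Lattice sites of Z^d are elements of int^'d, with d = CARD('d).\<close>

definition lnorm :: "int^'d \<Rightarrow> real" where
  "lnorm x = sqrt (\<Sum>i\<in>UNIV. (real_of_int (x $ i))^2)"

definition Qbox :: "real \<Rightarrow> (int^'d) set" where
  "Qbox a = {x. \<forall>i. - a / 2 \<le> real_of_int (x $ i) \<and> real_of_int (x $ i) \<le> a / 2}"

definition Qbox_at :: "real \<Rightarrow> int^'d \<Rightarrow> (int^'d) set" where
  "Qbox_at a x0 = (\<lambda>y. x0 + y) ` Qbox a"

definition ext0 :: "(int^'d) set \<Rightarrow> (int^'d \<Rightarrow> real) \<Rightarrow> int^'d \<Rightarrow> real" where
  "ext0 D f y = (if y \<in> D then f y else 0)"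

definition dir_op :: "(int^'d) set \<Rightarrow> (int^'d \<Rightarrow> real) \<Rightarrow> (int^'d \<Rightarrow> real) \<Rightarrow> int^'d \<Rightarrow> real" where
  "dir_op D V f x =
     (\<Sum>y\<in>{y. lnorm (y - x) = 1}. ext0 D f y - ext0 D f x) + V x * ext0 D f x"

definition is_eigpair :: "(int^'d) set \<Rightarrow> (int^'d \<Rightarrow> real) \<Rightarrow> real \<Rightarrow> (int^'d \<Rightarrow> real) \<Rightarrow> bool" where
  "is_eigpair D V lam f \<longleftrightarrow>
     (\<forall>x. x \<notin> D \<longrightarrow> f x = 0) \<and> (\<exists>x. f x \<noteq> 0) \<and> (\<forall>x\<in>D. dir_op D V f x = lam * f x)"

definition princ_eigval :: "(int^'d) set \<Rightarrow> (int^'d \<Rightarrow> real) \<Rightarrow> real" where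
  "princ_eigval D V = Max {lam. \<exists>f. is_eigpair D V lam f}"

definition is_princ_efun :: "(int^'d) set \<Rightarrow> (int^'d \<Rightarrow> real) \<Rightarrow> (int^'d \<Rightarrow> real) \<Rightarrow> bool" where
  "is_princ_efun D V f \<longleftrightarrow>
     is_eigpair D V (princ_eigval D V) f \<and> (\<forall>x. 0 \<le> f x) \<and> (\<Sum>x\<in>D. (f x)^2) = 1"

text \<open>Centred Gaussian field with covariance K: every finite linear combination of the
  field values is centred normal with variance given by K (via characteristic functions).\<close>
definition centred_gaussian_field :: "'w measure \<Rightarrow> ('w \<Rightarrow> 'i \<Rightarrow> real) \<Rightarrow> ('i \<Rightarrow> 'i \<Rightarrow> real) \<Rightarrow> bool" where
  "centred_gaussian_field M X K \<longleftrightarrow>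
     prob_space M \<and> (\<forall>x. (\<lambda>\<omega>. X \<omega> x) \<in> borel_measurable M) \<and>
     (\<forall>S c (t::real). finite S \<longrightarrow>
        integral\<^sup>L M (\<lambda>\<omega>. cis (t * (\<Sum>x\<in>S. c x * X \<omega> x)))
          = complex_of_real (exp (- (t^2 / 2) * (\<Sum>x\<in>S. \<Sum>y\<in>S. c x * c y * K x y))))"

definition var :: "'w measure \<Rightarrow> ('w \<Rightarrow> real) \<Rightarrow> real" where
  "var M Y = integral\<^sup>L M (\<lambda>\<omega>. (Y \<omega> - integral\<^sup>L M Y)^2)"

text \<open>d_L, defined by sup_{|x|=1} v_L(x) = 1 - 1/d_L.\<close>
definition dL :: "(int^'d \<Rightarrow> real) \<Rightarrow> real" where
  "dL vL = 1 / (1 - (SUP x\<in>{x. lnorm x = 1}. vL x))"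

definition Sfun :: "real \<Rightarrow> (int^'d \<Rightarrow> real) \<Rightarrow> int^'d \<Rightarrow> real" where
  "Sfun aL vL x = aL * (1 - vL x)"

definition zeta :: "(int^'d \<Rightarrow> real) \<Rightarrow> (int^'d \<Rightarrow> real) \<Rightarrow> int^'d \<Rightarrow> int^'d \<Rightarrow> real" where
  "zeta vL \<xi> x0 x = \<xi> x - \<xi> x0 * vL (x - x0)"

definition Phi :: "real \<Rightarrow> (int^'d \<Rightarrow> real) \<Rightarrow> (int^'d \<Rightarrow> real) \<Rightarrow> (int^'d \<Rightarrow> real) \<Rightarrow> int^'d \<Rightarrow> real" where
  "Phi rL phib vL \<xi> y = (\<Sum>x\<in>Qbox rL - {0}. (phib x)^2 * zeta vL \<xi> y (x + y))"

definition Xi :: "real \<Rightarrow> (int^'d \<Rightarrow> real) \<Rightarrow> (int^'d \<Rightarrow> real) \<Rightarrow> (int^'d \<Rightarrow> real) \<Rightarrow> int^'d \<Rightarrow> real" where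
  "Xi rL phib vL \<xi> y = \<xi> y + Phi rL phib vL \<xi> y"

definition in_event :: "'w measure \<Rightarrow> ('w \<Rightarrow> int^'d \<Rightarrow> real) \<Rightarrow> (int^'d \<Rightarrow> real) \<Rightarrow> real \<Rightarrow> real
    \<Rightarrow> int^'d \<Rightarrow> real \<Rightarrow> 'w \<Rightarrow> bool" where
  "in_event M X vL aL RL x0 \<kappa> \<omega> \<longleftrightarrow>
     \<bar>X \<omega> x0 - aL\<bar> < real (2 * CARD('d) + 1) \<and>
     (\<forall>x\<in>Qbox_at (2 * RL) x0. \<bar>zeta vL (X \<omega>) x0 x\<bar> \<le> Sfun aL vL (x - x0) / 10) \<and>
     (\<forall>x\<in>Qbox_at RL x0 - {x0}.
        \<bar>zeta vL (X \<omega>) x0 x\<bar> / sqrt (var M (\<lambda>\<omega>'. zeta vL (X \<omega>') x0 x))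
          \<le> (aL / dL vL) powr (\<kappa> * lnorm (x - x0)) * sqrt (max 1 (\<bar>X \<omega> x0 - aL\<bar> * aL)))"

end

theory Submission
  imports Defs
begin

text \<open>
  After recentring at $x_0$ and subtracting $\xi_L(x_0)$, the potential vanishes at the origin and on the
  event it is at most $-\frac45\mathcal S_L \le -G$ elsewhere, with $G$ of order $a_L/d_L$. Hence the
  operator has a spectral gap of order $G$ below its top eigenvalue, and $\bar\varphi_L(\cdot-x_0)$ is used
  as a trial function for it: if $\rho$ denotes its residual with respect to $\bar\lambda_L$, the component of
  the trial function orthogonal to $\varphi_{R_L}$ is $O(\|\rho\|/G)$ in norm, and the Rayleigh quotient
  differs from the eigenvalue by $O(\|\rho\|^2/G)$. The Rayleigh quotient equals
  $\bar\lambda_L+\Phi_L(x_0)$ up to an error $O((d_L/a_L)/a_L)$. The residual is controlled by the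
  pointwise bound $\bar\varphi_L(x)\le(K d_L/a_L)^{|x|_1}$, which follows by iterating the eigenvalue
  equation, together with the bounds on $\zeta_{L,x_0}$ in $E^3$; the part of $\rho$ outside
  $Q_{r_L,x_0}$ is negligible because $r_L\ge a_L$.
\<close>

section \<open>Symmetric kernels on finite sets\<close>

text \<open>The power 1 - 2\<kappa> results from a competition. The bounds in E^3 allow zeta to grow
  geometrically with the distance from x0: after squaring, by (a_L/d_L)^(2\<kappa>) per unit of
  distance. The squared eigenfunction decays by a multiple of (d_L/a_L)^2 per lattice step. Sums
  over the nonzero sites are therefore geometric with a ratio of order (d_L/a_L)^(2 - 2\<kappa>), so
  the first step away from the centre dominates. The variance of zeta contributes a further 1/d_L,
  which leaves (d_L/a_L)^(1 - 2\<kappa>)/a_L times max(1, |xi_L(x0) - a_L| a_L). This is at most a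
  constant times \<delta>, the bracket of the first claim. So the squared norm of \<rho> is
  O(\<delta>), and with G of order a_L/d_L the two rates of the trial function argument become the
  two claims. The gap is expressed as a bound of the quadratic form by the mass off one site, so the
  argument works with a single eigenvector throughout. Once L and the outcome are fixed, the
  estimate is deterministic; probability enters through the variance of zeta and the positivity of
  a_L.\<close>

definition ip :: "'a set \<Rightarrow> ('a \<Rightarrow> real) \<Rightarrow> ('a \<Rightarrow> real) \<Rightarrow> real" where
  "ip D f g = (\<Sum>x\<in>D. f x * g x)"

text \<open>Summing over \<open>D\<close> only is what later encodes the Dirichlet condition: values
  of \<open>f\<close> off \<open>D\<close> never enter, so test functions need no support
  assumption.\<close>

definition kapp :: "('a \<Rightarrow> 'a \<Rightarrow> real) \<Rightarrow> 'a set \<Rightarrow> ('a \<Rightarrow> real) \<Rightarrow> 'a \<Rightarrow> real" where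
  "kapp H D f x = (\<Sum>y\<in>D. H x y * f y)"

definition sym_kernel :: "('a \<Rightarrow> 'a \<Rightarrow> real) \<Rightarrow> 'a set \<Rightarrow> bool" where
  "sym_kernel H D \<longleftrightarrow> (\<forall>x\<in>D. \<forall>y\<in>D. H x y = H y x)"

lemma ip_commute: "ip D f g = ip D g f"
  by (simp add: ip_def mult.commute)

lemma ip_add_left: "ip D (\<lambda>x. f x + g x) h = ip D f h + ip D g h"
  by (simp add: ip_def distrib_right sum.distrib)

lemma ip_add_right: "ip D h (\<lambda>x. f x + g x) = ip D h f + ip D h g"
  by (simp add: ip_def distrib_left sum.distrib)

lemma ip_diff_left: "ip D (\<lambda>x. f x - g x) h = ip D f h - ip D g h"
  by (simp add: ip_def left_diff_distrib sum_subtractf)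

lemma ip_diff_right: "ip D h (\<lambda>x. f x - g x) = ip D h f - ip D h g"
  by (simp add: ip_def right_diff_distrib sum_subtractf)

lemma ip_scale_left: "ip D (\<lambda>x. t * f x) h = t * ip D f h"
  by (simp add: ip_def sum_distrib_left mult.assoc)

lemma ip_scale_right: "ip D h (\<lambda>x. t * f x) = t * ip D h f"
  by (simp add: ip_def sum_distrib_left mult_ac)

lemmas ip_linear = ip_add_left ip_add_right ip_diff_left ip_diff_right ip_scale_left ip_scale_right

lemma ip_self_nonneg: "0 \<le> ip D f f"
  by (simp add: ip_def sum_nonneg)

lemma ip_self_eq_0_iff: "finite D \<Longrightarrow> ip D f f = 0 \<longleftrightarrow> (\<forall>x\<in>D. f x = 0)"
  by (simp add: ip_def sum_nonneg_eq_0_iff)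

lemma ip_cong: "(\<And>x. x \<in> D \<Longrightarrow> f x = f' x) \<Longrightarrow> (\<And>x. x \<in> D \<Longrightarrow> g x = g' x) \<Longrightarrow> ip D f g = ip D f' g'"
  by (simp add: ip_def)

lemma ip_Cauchy_Schwarz: "(ip D f g)\<^sup>2 \<le> ip D f f * ip D g g"
  using Cauchy_Schwarz_ineq_sum[of f g D] by (simp add: ip_def power2_eq_square)

lemma ip_delta: "finite D \<Longrightarrow> x \<in> D \<Longrightarrow> ip D (\<lambda>y. if y = x then 1 else 0) f = f x"
  by (simp add: ip_def if_distrib[of "\<lambda>t. t * _"] cong: if_cong)

lemma kapp_add: "kapp H D (\<lambda>x. f x + g x) = (\<lambda>x. kapp H D f x + kapp H D g x)"
  by (simp add: kapp_def fun_eq_iff distrib_left sum.distrib)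

lemma kapp_scale: "kapp H D (\<lambda>x. t * f x) = (\<lambda>x. t * kapp H D f x)"
  by (simp add: kapp_def fun_eq_iff sum_distrib_left mult_ac)

lemma kapp_cong: "(\<And>x. x \<in> D \<Longrightarrow> f x = f' x) \<Longrightarrow> kapp H D f x = kapp H D f' x"
  by (simp add: kapp_def)

section \<open>Existence of a top eigenvector and finiteness of the spectrum\<close>

lemma ip_kapp_sym:
  assumes "sym_kernel H D"
  shows "ip D f (kapp H D g) = ip D g (kapp H D f)"
proof -
  have "ip D f (kapp H D g) = (\<Sum>x\<in>D. \<Sum>y\<in>D. f x * (H x y * g y))"
    by (simp add: ip_def kapp_def sum_distrib_left)
  also have "\<dots> = (\<Sum>y\<in>D. \<Sum>x\<in>D. f x * (H x y * g y))"
    by (rule sum.swap)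
  also have "\<dots> = (\<Sum>y\<in>D. \<Sum>x\<in>D. g y * (H y x * f x))"
    using assms by (intro sum.cong refl) (simp add: sym_kernel_def)
  also have "\<dots> = ip D g (kapp H D f)"
    by (simp add: ip_def kapp_def sum_distrib_left)
  finally show ?thesis .
qed

text \<open>Coordinates off \<open>D\<close> are pinned to 0 and those on \<open>D\<close> lie in
  [-1, 1], so the sphere is a closed subset of a product of compact sets. Tychonoff's theorem
  applies even when the index type is infinite.\<close>

lemma compact_unit_sphere_finite_support:
  assumes "finite D"
  shows "compact {u :: 'a \<Rightarrow> real. (\<forall>x. x \<notin> D \<longrightarrow> u x = 0) \<and> ip D u u = 1}" (is "compact ?S")
proof -
  let ?B = "\<lambda>x. if x \<in> D then {-1..1::real} else {0}"
  have "compactin (product_topology (\<lambda>_. euclidean) UNIV) (PiE UNIV ?B)"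
    by (auto simp: compactin_PiE)
  then have 1: "compact (PiE UNIV ?B)"
    by (simp add: euclidean_product_topology)
  have cont: "continuous_on UNIV (\<lambda>u :: 'a \<Rightarrow> real. ip D u u)"
    unfolding ip_def by (intro continuous_intros continuous_on_product_coordinates)
  have 2: "closed {u :: 'a \<Rightarrow> real. ip D u u = 1}"
    by (rule closed_Collect_eq[OF cont continuous_on_const])
  have "?S = PiE UNIV ?B \<inter> {u. ip D u u = 1}"
  proof (intro equalityI subsetI)
    fix u assume u: "u \<in> ?S"
    have "u x \<in> ?B x" for x
    proof (cases "x \<in> D")
      case True
      have "u x * u x \<le> ip D u u"
        unfolding ip_def using True assms by (intro member_le_sum) auto
      then have "\<bar>u x\<bar> \<le> 1" using u by (simp add: abs_square_le_1 power2_eq_square flip: power2_eq_square)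
      with True show ?thesis by auto
    qed (use u in auto)
    with u show "u \<in> PiE UNIV ?B \<inter> {u. ip D u u = 1}" by auto
  next
    fix u assume u: "u \<in> PiE UNIV ?B \<inter> {u. ip D u u = 1}"
    then have "u x \<in> ?B x" for x by (auto simp: PiE_def Pi_def)
    then have "u x = 0" if "x \<notin> D" for x by (metis that singletonD)
    with u show "u \<in> ?S" by auto
  qed
  with 1 2 show ?thesis by (simp add: compact_Int_closed)
qed

text \<open>Near t = 0 the linear term wins: t = b / k with k > |c| gives a positive value unless b
  = 0. This serves as the first-order condition at a maximiser.\<close>

lemma quadratic_nonpos_imp_linear_zero:
  fixes b c :: real
  assumes "\<And>t. 2 * t * b + t\<^sup>2 * c \<le> 0"
  shows "b = 0"
proof (rule ccontr)
  assume b: "b \<noteq> 0"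
  define k where "k = \<bar>c\<bar> + 1"
  have k: "k > 0" "\<bar>c\<bar> < k" by (auto simp: k_def)
  have "2 * (b / k) * b + (b / k)\<^sup>2 * c = (b\<^sup>2 / k\<^sup>2) * (2 * k + c)"
    using k by (simp add: field_simps power2_eq_square)
  moreover have "\<dots> > 0" using b k by (intro mult_pos_pos) auto
  ultimately show False using assms[of "b / k"] by simp
qed

text \<open>A maximiser of the quadratic form on the unit sphere is an eigenvector, because its
  first variation vanishes in every direction. By homogeneity the last conclusion extends from the
  sphere to arbitrary trial functions.\<close>

lemma top_eigenvector_exists:
  assumes fin: "finite D" and ne: "D \<noteq> {}" and sym: "sym_kernel H D"
  obtains lam u where "\<And>x. x \<notin> D \<Longrightarrow> u x = 0" "ip D u u = 1"
    "\<And>x. x \<in> D \<Longrightarrow> kapp H D u x = lam * u x" "\<And>g. ip D g (kapp H D g) \<le> lam * ip D g g"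
proof -
  define S where "S = {u :: 'a \<Rightarrow> real. (\<forall>x. x \<notin> D \<longrightarrow> u x = 0) \<and> ip D u u = 1}"
  have S_iff: "u \<in> S \<longleftrightarrow> (\<forall>x. x \<notin> D \<longrightarrow> u x = 0) \<and> ip D u u = 1" for u by (simp add: S_def)
  let ?q = "\<lambda>u. ip D u (kapp H D u)"
  obtain z where z: "z \<in> D" using ne by auto
  have "(\<lambda>y. if y = z then 1 else 0) \<in> S"
    using z fin ip_delta[of D z "\<lambda>y. if y = z then 1 else 0"] by (simp add: S_iff)
  then have "S \<noteq> {}" by auto
  moreover have "continuous_on S ?q"
    unfolding ip_def kapp_def
    by (intro continuous_on_sum continuous_on_mult continuous_on_const
        continuous_on_subset[OF continuous_on_product_coordinates subset_UNIV])
  ultimately obtain u where u: "u \<in> S" and umax: "\<And>g. g \<in> S \<Longrightarrow> ?q g \<le> ?q u"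
    using continuous_attains_sup[OF compact_unit_sphere_finite_support[OF fin, folded S_def]] by blast
  define lam where "lam = ?q u"
  have top: "?q g \<le> lam * ip D g g" for g
  proof (cases "ip D g g = 0")
    case True
    then have "\<forall>x\<in>D. g x = 0" using fin by (simp add: ip_self_eq_0_iff)
    then have "?q g = 0" by (simp add: ip_def)
    with True show ?thesis by simp
  next
    case False
    then have pos: "ip D g g > 0" using ip_self_nonneg[of D g] by simp
    \<comment> \<open>Normalise \<open>g\<close> and cut it off outside \<open>D\<close>, so that
      maximality on \<open>S\<close> applies.\<close>
    define s where "s = 1 / sqrt (ip D g g)"
    have s: "s * s * ip D g g = 1" using pos by (simp add: s_def field_simps)
    define h where "h = (\<lambda>x. s * (if x \<in> D then g x else 0))"
    have hg: "h x = s * g x" if "x \<in> D" for x using that by (simp add: h_def)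
    have "kapp H D h x = s * kapp H D g x" for x
      using kapp_cong[of D h "\<lambda>x. s * g x" H x] hg by (simp add: kapp_scale)
    then have "?q h = ip D (\<lambda>x. s * g x) (\<lambda>x. s * kapp H D g x)"
      using hg by (intro ip_cong) auto
    then have qh: "?q h = s * s * ?q g" by (simp add: ip_scale_left ip_scale_right)
    have "ip D h h = ip D (\<lambda>x. s * g x) (\<lambda>x. s * g x)" using hg by (intro ip_cong) auto
    then have "ip D h h = 1" using s by (simp add: ip_scale_left ip_scale_right)
    then have "h \<in> S" by (simp add: S_iff h_def)
    then have "s * s * ?q g \<le> lam" using umax qh lam_def by metis
    then have "s * s * ?q g * ip D g g \<le> lam * ip D g g" using pos by simp
    moreover have "s * s * ?q g * ip D g g = ?q g" using s by (simp add: mult_ac)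
    ultimately show ?thesis by simp
  qed
  have eig: "kapp H D u x = lam * u x" if x: "x \<in> D" for x
  proof -
    \<comment> \<open>A point mass as direction of variation turns the first-order condition into
      the eigenvalue equation at the single site \<open>x\<close>.\<close>
    let ?h = "\<lambda>y. if y = x then 1 else 0 :: real"
    have "2 * t * (ip D ?h (kapp H D u) - lam * ip D ?h u)
        + t\<^sup>2 * (?q ?h - lam * ip D ?h ?h) \<le> 0" for t
    proof -
      have "?q (\<lambda>y. u y + t * ?h y) \<le> lam * ip D (\<lambda>y. u y + t * ?h y) (\<lambda>y. u y + t * ?h y)"
        by (rule top)
      then show ?thesis
        using u[unfolded S_iff] ip_kapp_sym[OF sym, of u ?h] ip_commute[of D u ?h]
        unfolding kapp_add kapp_scale ip_linear lam_def
        by (simp add: algebra_simps power2_eq_square)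
    qed
    then have "ip D ?h (kapp H D u) - lam * ip D ?h u = 0"
      by (rule quadratic_nonpos_imp_linear_zero)
    then show ?thesis using x fin by (simp add: ip_delta)
  qed
  show ?thesis using that[of u lam] u[unfolded S_iff] eig top by blast
qed

text \<open>Normalised eigenvectors of distinct eigenvalues are orthonormal; sum Bessel's inequality over all points.\<close>

lemma card_eigenvalues_le:
  assumes fin: "finite D" and sym: "sym_kernel H D" and finT: "finite T"
    and T: "\<And>lam. lam \<in> T \<Longrightarrow> \<exists>f. ip D f f \<noteq> 0 \<and> (\<forall>x\<in>D. kapp H D f x = lam * f x)"
  shows "card T \<le> card D"
proof -
  have "\<exists>f. ip D f f = 1 \<and> (\<forall>x\<in>D. kapp H D f x = lam * f x)" if "lam \<in> T" for lam
  proof -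
    obtain f where f: "ip D f f \<noteq> 0" "\<forall>x\<in>D. kapp H D f x = lam * f x" using T \<open>lam \<in> T\<close> by blast
    define s where "s = 1 / sqrt (ip D f f)"
    have "s * s * ip D f f = 1"
      using f(1) ip_self_nonneg[of D f] by (simp add: s_def field_simps)
    then show ?thesis
      using f(2) by (intro exI[of _ "\<lambda>x. s * f x"]) (simp add: kapp_scale ip_linear mult.assoc)
  qed
  then obtain e where e1: "\<And>lam. lam \<in> T \<Longrightarrow> ip D (e lam) (e lam) = 1"
    and e2: "\<And>lam x. lam \<in> T \<Longrightarrow> x \<in> D \<Longrightarrow> kapp H D (e lam) x = lam * e lam x"
    by metis
  have orth: "ip D (e lam) (e mu) = 0" if "lam \<in> T" "mu \<in> T" "lam \<noteq> mu" for lam mu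
  proof -
    have "mu * ip D (e lam) (e mu) = ip D (e lam) (kapp H D (e mu))"
      using e2[OF that(2)] by (simp add: ip_scale_right[symmetric] cong: ip_cong)
    also have "\<dots> = ip D (e mu) (kapp H D (e lam))" by (rule ip_kapp_sym[OF sym])
    also have "\<dots> = lam * ip D (e mu) (e lam)"
      using e2[OF that(1)] by (simp add: ip_scale_right[symmetric] cong: ip_cong)
    finally show ?thesis using that(3) by (simp add: ip_commute)
  qed
  have Bessel: "(\<Sum>lam\<in>T. (e lam x)\<^sup>2) \<le> 1" if x: "x \<in> D" for x
  proof -
    let ?h = "\<lambda>y. if y = x then 1 else 0 :: real"
    \<comment> \<open>The orthogonal projection of the point mass at \<open>x\<close> onto the span
      of the \<open>e lam\<close>; its squared norm is the sum to be bounded.\<close>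
    let ?p = "\<lambda>y. \<Sum>lam\<in>T. e lam x * e lam y"
    have ipp: "ip D ?p g = (\<Sum>lam\<in>T. e lam x * ip D (e lam) g)" for g
      unfolding ip_def by (simp add: sum_distrib_right sum_distrib_left mult.assoc, subst sum.swap, simp)
    have "ip D (e lam) ?p = e lam x" if "lam \<in> T" for lam
    proof -
      have "ip D (e lam) ?p = (\<Sum>mu\<in>T. e mu x * ip D (e mu) (e lam))"
        by (subst ip_commute) (rule ipp)
      also have "\<dots> = (\<Sum>mu\<in>T. if mu = lam then e lam x else 0)"
        using that orth e1 by (intro sum.cong) auto
      finally show ?thesis using that finT by simp
    qed
    then have pp: "ip D ?p ?p = (\<Sum>lam\<in>T. (e lam x)\<^sup>2)" by (simp add: ipp power2_eq_square)
    have "0 \<le> ip D (\<lambda>y. ?h y - ?p y) (\<lambda>y. ?h y - ?p y)" by (rule ip_self_nonneg)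
    also have "\<dots> = 1 - 2 * ip D ?h ?p + ip D ?p ?p"
      using x fin unfolding ip_diff_left ip_diff_right ip_commute[of D ?p ?h]
      by (simp add: ip_delta)
    also have "ip D ?h ?p = (\<Sum>lam\<in>T. (e lam x)\<^sup>2)"
      using x fin by (simp add: ip_delta power2_eq_square)
    finally show ?thesis using pp by simp
  qed
  have "real (card T) = (\<Sum>lam\<in>T. ip D (e lam) (e lam))" using e1 by simp
  also have "\<dots> = (\<Sum>x\<in>D. \<Sum>lam\<in>T. (e lam x)\<^sup>2)"
    unfolding ip_def by (subst sum.swap) (simp add: power2_eq_square)
  also have "\<dots> \<le> (\<Sum>x\<in>D. 1)" using Bessel by (intro sum_mono)
  finally show ?thesis by simp
qed

text \<open>Split \<psi> = \<alpha>\<phi> + w with w orthogonal to \<phi>. Since w has little mass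
  at \<open>x0\<close>, the form is very negative on w, and pairing w with the residual bounds its
  norm by a multiple of the norm of \<rho> over G. The number \<open>mu\<close> need not be an
  eigenvalue of \<open>H\<close>; it only has to lie in [-N, 0], as \<open>lam\<close> does, so that
  both are small against G.\<close>

lemma rayleigh_residual_bounds:
  assumes fin: "finite D" and sym: "sym_kernel H D" and x0: "x0 \<in> D"
    and gap: "\<And>g. ip D g (kapp H D g) \<le> - G * (ip D g g - (g x0)\<^sup>2)"
    and N: "0 < N" and G: "4 * N \<le> G"
    and phi: "ip D \<phi> \<phi> = 1" "\<And>x. x \<in> D \<Longrightarrow> kapp H D \<phi> x = lam * \<phi> x" and lam: "- N \<le> lam"
    and psi: "ip D \<psi> \<psi> = 1" and mu: "- N \<le> mu" "mu \<le> 0"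
    and rho: "\<And>x. x \<in> D \<Longrightarrow> \<rho> x = kapp H D \<psi> x - mu * \<psi> x"
  shows "1 - (ip D \<phi> \<psi>)\<^sup>2 \<le> 9 * ip D \<rho> \<rho> / G\<^sup>2"
    and "\<bar>lam - ip D \<psi> (kapp H D \<psi>)\<bar> \<le> 6 * ip D \<rho> \<rho> / G"
proof -
  define \<alpha> where "\<alpha> = ip D \<phi> \<psi>"
  define w where "w = (\<lambda>x. \<psi> x - \<alpha> * \<phi> x)"
  define P where "P = ip D \<rho> \<rho>"
  define W where "W = ip D w w"
  have Gpos: "G > 0" using N G by simp
  have P0: "P \<ge> 0" "W \<ge> 0" by (simp_all add: P_def W_def ip_self_nonneg)
  have wphi: "ip D w \<phi> = 0"
    unfolding w_def ip_linear using phi(1) by (simp add: \<alpha>_def ip_commute)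
  have W: "W = 1 - \<alpha>\<^sup>2"
    unfolding W_def w_def ip_linear using phi(1) psi
    by (simp add: \<alpha>_def ip_commute[of D \<psi> \<phi>] power2_eq_square)
  have Hphi: "ip D g (kapp H D \<phi>) = lam * ip D g \<phi>" for g
    using phi(2) by (simp add: ip_scale_right[symmetric] cong: ip_cong)
  have lam_le: "lam \<le> - G * (1 - (\<phi> x0)\<^sup>2)" using gap[of \<phi>] Hphi phi(1) by simp
  have sq_le: "(g x0)\<^sup>2 \<le> ip D g g" for g
    unfolding ip_def power2_eq_square using x0 fin by (intro member_le_sum[of x0 D "\<lambda>x. g x * g x"]) auto
  have lam0: "lam \<le> 0"
    using lam_le sq_le[of \<phi>] phi(1) Gpos by (smt (verit, best) mult_minus_left mult_nonneg_nonneg)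
  have "G * (1 - (\<phi> x0)\<^sup>2) \<le> G * (1/4)" using lam_le lam G by simp
  then have phi0: "1 - (\<phi> x0)\<^sup>2 \<le> 1/4" using Gpos by (simp only: mult_le_cancel_left_pos)
  \<comment> \<open>The unit vector \<open>\<phi>\<close> carries almost all its mass at \<open>x0\<close>, so \<open>w\<close>, being orthogonal to it, carries little there.\<close>
  have w0: "3 * (w x0)\<^sup>2 \<le> W"
  proof -
    have off: "ip (D - {x0}) f g = ip D f g - f x0 * g x0" for f g
      unfolding ip_def using x0 fin by (simp add: sum_diff1)
    have "(w x0 * \<phi> x0)\<^sup>2 = (ip (D - {x0}) w \<phi>)\<^sup>2" by (simp add: off wphi)
    also have "\<dots> \<le> ip (D - {x0}) w w * ip (D - {x0}) \<phi> \<phi>" by (rule ip_Cauchy_Schwarz)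
    also have "\<dots> = (W - (w x0)\<^sup>2) * (1 - (\<phi> x0)\<^sup>2)"
      by (simp add: off W_def phi(1) power2_eq_square)
    finally have "(w x0)\<^sup>2 \<le> W * (1 - (\<phi> x0)\<^sup>2)"
      by (simp add: power_mult_distrib algebra_simps)
    also have "\<dots> \<le> W * (1/4)" using phi0 P0 by (intro mult_left_mono) auto
    finally show ?thesis using zero_le_power2[of "w x0"] by linarith
  qed
  have wrho: "ip D w \<rho> = ip D w (kapp H D w) - mu * W"
  proof -
    have "ip D w \<rho> = ip D w (kapp H D \<psi>) - mu * ip D w \<psi>"
      using rho by (simp add: ip_linear cong: ip_cong)
    moreover have "\<psi> = (\<lambda>x. w x + \<alpha> * \<phi> x)" by (simp add: w_def)
    then have "ip D w (kapp H D \<psi>) = ip D w (kapp H D w)" "ip D w \<psi> = W"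
      using wphi by (simp_all add: kapp_add kapp_scale ip_linear Hphi W_def)
    ultimately show ?thesis by simp
  qed
  \<comment> \<open>The concentration of \<phi> leaves 2/3 of the gap, the shift by
    \<open>mu\<close> costs at most N \<le> G/4, and 2/3 - 1/4 exceeds 1/3.\<close>
  have "G / 3 * W \<le> - ip D w \<rho>"
  proof -
    have "G * (2/3 * W) \<le> G * (W - (w x0)\<^sup>2)" using w0 Gpos by (intro mult_left_mono) auto
    moreover have "- mu * W \<le> G / 4 * W" using mu G P0 by (intro mult_right_mono) auto
    moreover have "G / 3 * W \<le> G * (2/3 * W) - G / 4 * W" using P0 Gpos by (simp add: field_simps)
    ultimately show ?thesis using gap[of w] wrho by (simp add: W_def)
  qed
  moreover have "\<bar>ip D w \<rho>\<bar>\<^sup>2 \<le> W * P" using ip_Cauchy_Schwarz[of D w \<rho>] by (simp add: W_def P_def)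
  ultimately have main: "W \<le> 9 * P / G\<^sup>2" "\<bar>ip D w \<rho>\<bar> \<le> 3 * P / G"
  proof -
    assume 1: "G / 3 * W \<le> - ip D w \<rho>" and 2: "\<bar>ip D w \<rho>\<bar>\<^sup>2 \<le> W * P"
    have "(G / 3 * W)\<^sup>2 \<le> \<bar>ip D w \<rho>\<bar>\<^sup>2" using 1 P0 Gpos by (intro power_mono) auto
    with 2 have "(G / 3 * W)\<^sup>2 \<le> W * P" by linarith
    then have "W * (G\<^sup>2 / 9 * W) \<le> W * P" by (simp add: power2_eq_square mult_ac)
    then show a: "W \<le> 9 * P / G\<^sup>2"
    \<comment> \<open>A factor W has to be cancelled; if W = 0 the bound is trivial.\<close>
    proof (cases "W = 0")
      case False
      then have "G\<^sup>2 / 9 * W \<le> P" using P0 \<open>W * (G\<^sup>2 / 9 * W) \<le> W * P\<close> by (simp add: mult_le_cancel_left)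
      then show ?thesis using Gpos by (simp add: field_simps)
    qed (use P0 in auto)
    have "\<bar>ip D w \<rho>\<bar>\<^sup>2 \<le> (9 * P / G\<^sup>2) * P" using 2 a P0 by (meson mult_right_mono order_trans)
    also have "\<dots> = (3 * P / G)\<^sup>2" by (simp add: power2_eq_square)
    finally show "\<bar>ip D w \<rho>\<bar> \<le> 3 * P / G"
      by (rule power2_le_imp_le) (use P0 Gpos in auto)
  qed
  show "1 - (ip D \<phi> \<psi>)\<^sup>2 \<le> 9 * ip D \<rho> \<rho> / G\<^sup>2" using main(1) W by (simp add: P_def \<alpha>_def)
  have phirho: "ip D \<phi> \<rho> = \<alpha> * (lam - mu)"
  proof -
    have "ip D \<phi> \<rho> = ip D \<phi> (kapp H D \<psi>) - mu * \<alpha>"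
      using rho by (simp add: ip_linear \<alpha>_def cong: ip_cong)
    then show ?thesis using ip_kapp_sym[OF sym, of \<phi> \<psi>] Hphi[of \<psi>]
      by (simp add: \<alpha>_def ip_commute algebra_simps)
  qed
  have psirho: "ip D \<psi> \<rho> = ip D \<psi> (kapp H D \<psi>) - mu"
    using rho psi by (simp add: ip_linear cong: ip_cong)
  \<comment> \<open>Pairing the residual with both parts of \<psi> and inserting \<alpha>^2 = 1 - W
    expresses the eigenvalue error by two terms that are already quadratic in \<rho>. Hence the
    crude bound G/4 for the distance of \<open>lam\<close> and \<open>mu\<close> suffices.\<close>
  have "ip D \<psi> \<rho> = \<alpha> * ip D \<phi> \<rho> + ip D w \<rho>"
    unfolding w_def by (simp add: ip_linear)
  then have "lam - ip D \<psi> (kapp H D \<psi>) = W * (lam - mu) - ip D w \<rho>"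
    using psirho phirho unfolding W by (simp add: algebra_simps power2_eq_square)
  moreover have "\<bar>W * (lam - mu)\<bar> \<le> 3 * P / G"
  proof -
    have "\<bar>W * (lam - mu)\<bar> \<le> W * (G / 4)"
      unfolding abs_mult using P0 lam lam0 mu G by (intro mult_mono) linarith+
    also have "\<dots> \<le> 9 * P / G\<^sup>2 * (G / 4)" using main(1) Gpos by (intro mult_right_mono) auto
    also have "\<dots> \<le> 3 * P / G" using P0 Gpos by (simp add: field_simps power2_eq_square)
    finally show ?thesis .
  qed
  ultimately show "\<bar>lam - ip D \<psi> (kapp H D \<psi>)\<bar> \<le> 6 * ip D \<rho> \<rho> / G"
    using main(2) by (simp add: P_def)
qed

section \<open>Lattice geometry and Dirichlet operators\<close>

text \<open>The 2d unit steps of the lattice. The cardinality of this set is the degree constant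
  \<open>N\<close> of all later estimates.\<close>

definition nbhd0 :: "(int^'d) set" where
  "nbhd0 = {z. lnorm z = 1}"

text \<open>The graph distance to the origin. Each use of the eigenvalue equation moves one lattice
  step, so decay is measured in this distance and not in the Euclidean norm.\<close>

definition l1 :: "int^'d \<Rightarrow> nat" where
  "l1 x = nat (\<Sum>i\<in>UNIV. \<bar>x $ i\<bar>)"

lemma of_nat_l1: "int (l1 x) = (\<Sum>i\<in>UNIV. \<bar>x $ i\<bar>)"
  by (simp add: l1_def sum_nonneg)

lemma lnorm_minus_commute: "lnorm (x - y) = lnorm (y - x)"
  by (simp add: lnorm_def power2_commute)

lemma lnorm_0 [simp]: "lnorm 0 = 0"
  by (simp add: lnorm_def)

lemma lnorm_nonneg: "0 \<le> lnorm x"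
  by (simp add: lnorm_def sum_nonneg)

lemma lnorm_le_l1: "lnorm x \<le> real (l1 x)"
proof -
  have "lnorm x \<le> (\<Sum>i\<in>UNIV. \<bar>real_of_int (x $ i)\<bar>)"
    using L2_set_le_sum_abs[of "\<lambda>i. real_of_int (x $ i)" UNIV] by (simp add: lnorm_def L2_set_def)
  also have "\<dots> = real_of_int (int (l1 x))" unfolding of_nat_l1 by simp
  finally show ?thesis by simp
qed

lemma abs_component_le_lnorm: "\<bar>real_of_int (x $ i)\<bar> \<le> lnorm x"
proof -
  have "(real_of_int (x $ i))\<^sup>2 \<le> (\<Sum>i\<in>UNIV. (real_of_int (x $ i))\<^sup>2)"
    by (rule member_le_sum) auto
  then show ?thesis unfolding lnorm_def by (metis real_sqrt_abs real_sqrt_le_mono)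
qed

lemma l1_le_1_of_nbhd0:
  assumes "z \<in> nbhd0" shows "l1 z \<le> 1"
proof -
  have "(\<Sum>i\<in>UNIV. (real_of_int (z $ i))\<^sup>2) = 1"
    using assms by (simp add: nbhd0_def lnorm_def)
  then have "real_of_int (\<Sum>i\<in>UNIV. (z $ i)\<^sup>2) = 1" by simp
  then have 1: "(\<Sum>i\<in>UNIV. (z $ i)\<^sup>2) = 1" by linarith
  have "\<bar>k\<bar> \<le> k\<^sup>2" for k :: int
  proof (cases "k = 0")
    case False
    then have "\<bar>k\<bar> * 1 \<le> \<bar>k\<bar> * \<bar>k\<bar>" by (intro mult_left_mono) auto
    then show ?thesis by (simp add: power2_eq_square)
  qed simp
  then have "int (l1 z) \<le> (\<Sum>i\<in>UNIV. (z $ i)\<^sup>2)"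
    unfolding of_nat_l1 by (intro sum_mono)
  with 1 show ?thesis by simp
qed

lemma l1_triangle: "l1 (x + y) \<le> l1 x + l1 y"
proof -
  have "int (l1 (x + y)) \<le> int (l1 x) + int (l1 y)"
    unfolding of_nat_l1 sum.distrib[symmetric] by (intro sum_mono) auto
  then show ?thesis by linarith
qed

lemma l1_eq_0_iff: "l1 x = 0 \<longleftrightarrow> x = 0"
proof -
  have "l1 x = 0 \<longleftrightarrow> int (l1 x) = 0" by simp
  also have "\<dots> \<longleftrightarrow> (\<forall>i. x $ i = 0)" unfolding of_nat_l1 by (simp add: sum_nonneg_eq_0_iff)
  finally show ?thesis by (simp add: vec_eq_iff)
qed

lemma l1_le_Suc_of_neighbour:
  assumes "lnorm (y - x) = 1" shows "l1 x \<le> Suc (l1 y)"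
proof -
  have "x - y \<in> nbhd0" using assms by (simp add: nbhd0_def lnorm_minus_commute)
  then show ?thesis using l1_triangle[of y "x - y"] l1_le_1_of_nbhd0[of "x - y"] by simp
qed

lemma finite_Qbox: "finite (Qbox a :: (int^'d) set)"
proof -
  let ?B = "{\<lfloor>- a / 2\<rfloor>..\<lceil>a / 2\<rceil>}"
  have "Qbox a \<subseteq> vec_lambda ` (PiE UNIV (\<lambda>_::'d. ?B))"
  proof
    fix x :: "int^'d" assume x: "x \<in> Qbox a"
    then have "x $ i \<in> ?B" for i by (auto simp: Qbox_def floor_le_iff le_ceiling_iff) (smt (verit) x)+
    then have "vec_nth x \<in> PiE UNIV (\<lambda>_. ?B)" by auto
    then show "x \<in> vec_lambda ` (PiE UNIV (\<lambda>_::'d. ?B))" by (metis image_eqI vec_nth_inverse)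
  qed
  moreover have "finite (vec_lambda ` (PiE UNIV (\<lambda>_::'d. ?B)))" by (intro finite_imageI finite_PiE) auto
  ultimately show ?thesis by (rule finite_subset)
qed

lemma finite_nbhd0: "finite (nbhd0 :: (int^'d) set)"
proof (rule finite_subset[OF _ finite_Qbox[of 2]])
  show "nbhd0 \<subseteq> (Qbox 2 :: (int^'d) set)"
  proof
    fix z :: "int^'d" assume "z \<in> nbhd0"
    then have "\<bar>real_of_int (z $ i)\<bar> \<le> 1" for i using abs_component_le_lnorm[of z i] by (simp add: nbhd0_def)
    then show "z \<in> Qbox 2" by (simp add: Qbox_def abs_le_iff)
  qed
qed

lemma axis_in_nbhd0: "\<bar>s\<bar> = 1 \<Longrightarrow> axis i s \<in> nbhd0"
proof -
  assume s: "\<bar>s\<bar> = 1"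
  have "(\<Sum>j\<in>UNIV. (real_of_int (axis i s $ j))\<^sup>2) = (\<Sum>j\<in>UNIV. if j = i then 1 else 0)"
    using s by (intro sum.cong) (auto simp: axis_def power2_eq_1_iff abs_if split: if_splits)
  then show ?thesis by (simp add: nbhd0_def lnorm_def)
qed

lemma nbhd0_nonempty: "nbhd0 \<noteq> {}"
  using axis_in_nbhd0[of 1] by force

lemma card_nbhd0_pos: "0 < card (nbhd0 :: (int^'d) set)"
  using finite_nbhd0 nbhd0_nonempty by (simp add: card_gt_0_iff)

section \<open>Lattice spheres and geometric sums over them\<close>

lemma l1_step:
  assumes "x \<noteq> 0"
  obtains z where "z \<in> nbhd0" "Suc (l1 (x - z)) = l1 x"
proof -
  obtain i where i: "x $ i \<noteq> 0" using assms by (auto simp: vec_eq_iff)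
  define z where "z = axis i (sgn (x $ i))"
  have z: "z \<in> nbhd0" unfolding z_def using i by (intro axis_in_nbhd0) (simp add: abs_sgn_eq)
  have "int (l1 (x - z)) = (\<Sum>j\<in>UNIV. \<bar>x $ j\<bar> - (if j = i then 1 else 0))"
    unfolding of_nat_l1 z_def using i by (intro sum.cong) (auto simp: axis_def sgn_if)
  also have "\<dots> = int (l1 x) - 1" by (simp add: sum_subtractf of_nat_l1)
  finally have "Suc (l1 (x - z)) = l1 x" by linarith
  with z that show ?thesis by blast
qed

text \<open>Every point of sphere n + 1 is a point of sphere n plus a unit step. The bound is crude,
  but exponential growth is all that a comparison with a geometric series requires.\<close>

lemma l1_sphere_card:
  "finite {x :: int^'d. l1 x = n} \<and> card {x :: int^'d. l1 x = n} \<le> card (nbhd0 :: (int^'d) set) ^ n"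
proof (induction n)
  case 0
  have "{x :: int^'d. l1 x = 0} = {0}" by (auto simp: l1_eq_0_iff)
  then show ?case by simp
next
  case (Suc n)
  let ?f = "\<lambda>(z, y). y + z :: int^'d"
  have sub: "{x :: int^'d. l1 x = Suc n} \<subseteq> ?f ` (nbhd0 \<times> {x. l1 x = n})"
  proof
    fix x :: "int^'d" assume x: "x \<in> {x. l1 x = Suc n}"
    then have "x \<noteq> 0" using l1_eq_0_iff[of x] by auto
    then obtain z where "z \<in> nbhd0" "Suc (l1 (x - z)) = l1 x" using l1_step by blast
    with x show "x \<in> ?f ` (nbhd0 \<times> {x. l1 x = n})" by (intro image_eqI[of _ _ "(z, x - z)"]) auto
  qed
  have fin: "finite ((nbhd0 :: (int^'d) set) \<times> {x :: int^'d. l1 x = n})" using Suc finite_nbhd0 by auto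
  have "card {x :: int^'d. l1 x = Suc n} \<le> card ((nbhd0 :: (int^'d) set) \<times> {x :: int^'d. l1 x = n})"
    by (rule surj_card_le[OF fin sub])
  also have "\<dots> \<le> card (nbhd0 :: (int^'d) set) * card (nbhd0 :: (int^'d) set) ^ n"
    using Suc by (simp add: card_cartesian_product)
  finally show ?case using finite_subset[OF sub] fin by simp
qed

text \<open>The value of \<open>b\<close> is chosen so that the sphere of radius n contributes at
  most 2^(-n), whatever the finite set \<open>F\<close> is.\<close>

lemma sum_power_l1_le:
  fixes F :: "(int^'d) set"
  assumes fin: "finite F"
  defines "b \<equiv> 1 / (2 * real (card (nbhd0 :: (int^'d) set)))"
  shows "(\<Sum>x\<in>F. b ^ l1 x) \<le> 2"
proof -
  let ?N = "card (nbhd0 :: (int^'d) set)"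
  define m where "m = Max (l1 ` F)"
  have b0: "0 \<le> b" by (simp add: b_def)
  have "(\<Sum>x\<in>F. b ^ l1 x) = (\<Sum>n\<in>{..m}. \<Sum>x\<in>{x. x \<in> F \<and> l1 x = n}. b ^ l1 x)"
    using fin by (intro sum.group[symmetric]) (auto simp: m_def)
  also have "\<dots> \<le> (\<Sum>n\<in>{..m}. (1/2) ^ n)"
  proof (intro sum_mono)
    fix n
    have "(\<Sum>x\<in>{x. x \<in> F \<and> l1 x = n}. b ^ l1 x) \<le> (\<Sum>x | l1 x = n. b ^ l1 (x :: int^'d))"
      using l1_sphere_card b0 by (intro sum_mono2) auto
    also have "\<dots> = real (card {x :: int^'d. l1 x = n}) * b ^ n" by simp
    also have "\<dots> \<le> real (?N ^ n) * b ^ n"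
      using l1_sphere_card[where 'd = 'd] b0 by (intro mult_right_mono) (auto simp del: of_nat_power)
    also have "\<dots> = (1/2) ^ n"
      using card_nbhd0_pos[where 'd = 'd] by (simp add: b_def power_mult_distrib[symmetric])
    finally show "(\<Sum>x\<in>{x. x \<in> F \<and> l1 x = n}. b ^ l1 x) \<le> (1/2) ^ n" .
  qed
  also have "\<dots> \<le> 2"
    using sum_gp_basic[of "1/2 :: real" m] by simp
  finally show ?thesis .
qed

text \<open>Away from the origin every exponent is at least 1, so one factor q / b can be taken out
  before comparing with powers of b. This factor is the source of smallness in the weighted
  sums.\<close>

lemma sum_power_l1_off_origin_le:
  fixes F :: "(int^'d) set"
  assumes fin: "finite F" "0 \<notin> F" and q: "0 \<le> q" "2 * real (card (nbhd0 :: (int^'d) set)) * q \<le> 1"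
  shows "(\<Sum>x\<in>F. q ^ l1 x) \<le> 4 * real (card (nbhd0 :: (int^'d) set)) * q"
proof -
  define b where "b = 1 / (2 * real (card (nbhd0 :: (int^'d) set)))"
  have b: "0 < b" "q \<le> b" using q card_nbhd0_pos[where 'd = 'd] by (auto simp: b_def field_simps)
  have "(\<Sum>x\<in>F. q ^ l1 x) \<le> (\<Sum>x\<in>F. (q / b) * b ^ l1 x)"
  proof (intro sum_mono)
    fix x assume "x \<in> F"
    then have "x \<noteq> 0" using fin by auto
    then obtain n where n: "l1 x = Suc n" using l1_eq_0_iff[of x] by (cases "l1 x") auto
    have "q ^ n \<le> b ^ n" using q b by (intro power_mono)
    then show "q ^ l1 x \<le> (q / b) * b ^ l1 x" using n q b by (simp add: mult_left_mono)
  qed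
  also have "\<dots> = (q / b) * (\<Sum>x\<in>F. b ^ l1 x)" by (simp add: sum_distrib_left)
  also have "\<dots> \<le> (q / b) * 2"
    using sum_power_l1_le[OF fin(1)] q b by (intro mult_left_mono) (auto simp: b_def)
  finally show ?thesis by (simp add: b_def mult_ac)
qed

lemma l1_gt_of_notin_Qbox:
  assumes "x \<notin> Qbox r" shows "r / 2 < real (l1 x)"
proof -
  obtain i where "\<not> (- r / 2 \<le> real_of_int (x $ i) \<and> real_of_int (x $ i) \<le> r / 2)"
    using assms by (auto simp: Qbox_def)
  then have "r / 2 < \<bar>real_of_int (x $ i)\<bar>" by linarith
  then show ?thesis using abs_component_le_lnorm[of x i] lnorm_le_l1[of x] by linarith
qed

section \<open>The Dirichlet operator as a symmetric kernel\<close>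

lemma neighbours_eq_image: "{y. lnorm (y - x) = 1} = (\<lambda>z. x + z) ` nbhd0"
proof (intro equalityI subsetI)
  fix y assume "y \<in> {y. lnorm (y - x) = 1}"
  then show "y \<in> (\<lambda>z. x + z) ` nbhd0" by (intro image_eqI[of _ _ "y - x"]) (auto simp: nbhd0_def)
qed (auto simp: nbhd0_def)

lemma finite_neighbours: "finite {y. lnorm (y - x) = 1}"
  by (simp add: neighbours_eq_image finite_nbhd0)

lemma card_neighbours: "card {y. lnorm (y - x) = 1} = card (nbhd0 :: (int^'d) set)" for x :: "int^'d"
  by (simp add: neighbours_eq_image card_image)

text \<open>The diagonal subtracts the full degree whatever \<open>D\<close> is: steps that leave
  \<open>D\<close> still count as losses, which is exactly extension by 0.\<close>

definition dker :: "(int^'d \<Rightarrow> real) \<Rightarrow> int^'d \<Rightarrow> int^'d \<Rightarrow> real" where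
  "dker V x y = (if lnorm (y - x) = 1 then 1 else 0)
     + (if y = x then V x - real (card (nbhd0 :: (int^'d) set)) else 0)"

lemma sym_kernel_dker: "sym_kernel (dker V) D"
  by (auto simp: sym_kernel_def dker_def lnorm_minus_commute)

lemma kapp_dker:
  fixes D :: "(int^'d) set"
  assumes "finite D" "x \<in> D"
  shows "kapp (dker V) D f x = (\<Sum>y\<in>D \<inter> {y. lnorm (y - x) = 1}. f y)
    + (V x - real (card (nbhd0 :: (int^'d) set))) * f x"
proof -
  have "kapp (dker V) D f x = (\<Sum>y\<in>D. (if lnorm (y - x) = 1 then f y else 0)
     + (if y = x then (V x - real (card (nbhd0 :: (int^'d) set))) * f x else 0))"
    unfolding kapp_def by (intro sum.cong) (auto simp: dker_def algebra_simps)
  then show ?thesis using assms by (simp add: sum.distrib sum.inter_restrict)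
qed

lemma dir_op_eq_kapp:
  assumes "finite D" "x \<in> D"
  shows "dir_op D V f x = kapp (dker V) D f x"
proof -
  have "(\<Sum>y\<in>{y. lnorm (y - x) = 1}. ext0 D f y) = (\<Sum>y\<in>D \<inter> {y. lnorm (y - x) = 1}. f y)"
    unfolding ext0_def Int_commute[of D] by (rule sum.inter_restrict[OF finite_neighbours, symmetric])
  then show ?thesis using assms
    by (simp add: dir_op_def kapp_dker sum_subtractf card_neighbours) (simp add: ext0_def algebra_simps)
qed

lemma kapp_dker_shift:
  assumes "finite D" "x \<in> D"
  shows "kapp (dker (\<lambda>x. V x - t)) D f x = kapp (dker V) D f x - t * f x"
  using assms by (simp add: kapp_dker algebra_simps)

lemma ip_dker_delta:
  fixes D :: "(int^'d) set"
  assumes "finite D" "x \<in> D"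
  shows "ip D (\<lambda>y. if y = x then 1 else 0) (kapp (dker V) D (\<lambda>y. if y = x then 1 else 0))
    = V x - real (card (nbhd0 :: (int^'d) set))"
proof -
  have "kapp (dker V) D (\<lambda>y. if y = x then 1 else 0) x = dker V x x"
    unfolding kapp_def using assms by (simp add: if_distrib[of "\<lambda>t. _ * t"] cong: if_cong)
  then show ?thesis using assms by (simp add: ip_delta dker_def)
qed

text \<open>The Dirichlet Laplacian is nonpositive: bound g(x) g(y) by half the sum of the squares
  and use that every row of the adjacency kernel sums to at most the degree.\<close>

lemma ip_dker_le_potential:
  fixes D :: "(int^'d) set"
  assumes "finite D"
  shows "ip D g (kapp (dker V) D g) \<le> (\<Sum>x\<in>D. V x * (g x)\<^sup>2)"
proof -
  let ?N = "real (card (nbhd0 :: (int^'d) set))"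
  let ?A = "\<lambda>x y. if lnorm (y - x) = 1 then 1 else 0 :: real"
  have row: "(\<Sum>y\<in>D. ?A x y) \<le> ?N" for x
  proof -
    have "(\<Sum>y\<in>D. ?A x y) = real (card (D \<inter> {y. lnorm (y - x) = 1}))"
      using assms sum.inter_restrict[of D "\<lambda>_. 1::real" "{y. lnorm (y - x) = 1}"] by simp
    also have "\<dots> \<le> ?N"
      using card_mono[OF finite_neighbours[of x], of "D \<inter> {y. lnorm (y - x) = 1}"] card_neighbours[of x] by simp
    finally show ?thesis .
  qed
  have "(\<Sum>x\<in>D. \<Sum>y\<in>D. ?A x y * (g x * g y)) \<le> (\<Sum>x\<in>D. \<Sum>y\<in>D. ?A x y * ((g x)\<^sup>2 / 2) + ?A x y * ((g y)\<^sup>2 / 2))"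
  proof (intro sum_mono)
    fix x y
    have "g x * g y \<le> (g x)\<^sup>2 / 2 + (g y)\<^sup>2 / 2"
      using zero_le_power2[of "g x - g y"] by (simp add: power2_diff)
    then show "?A x y * (g x * g y) \<le> ?A x y * ((g x)\<^sup>2 / 2) + ?A x y * ((g y)\<^sup>2 / 2)"
      by simp
  qed
  also have "\<dots> = (\<Sum>x\<in>D. \<Sum>y\<in>D. ?A x y * ((g x)\<^sup>2 / 2)) + (\<Sum>x\<in>D. \<Sum>y\<in>D. ?A x y * ((g y)\<^sup>2 / 2))"
    by (simp only: sum.distrib)
  also have "(\<Sum>x\<in>D. \<Sum>y\<in>D. ?A x y * ((g y)\<^sup>2 / 2)) = (\<Sum>x\<in>D. \<Sum>y\<in>D. ?A x y * ((g x)\<^sup>2 / 2))"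
    by (subst sum.swap) (simp add: lnorm_minus_commute)
  also have "(\<Sum>x\<in>D. \<Sum>y\<in>D. ?A x y * ((g x)\<^sup>2 / 2)) + (\<Sum>x\<in>D. \<Sum>y\<in>D. ?A x y * ((g x)\<^sup>2 / 2))
      = (\<Sum>x\<in>D. (\<Sum>y\<in>D. ?A x y) * (g x)\<^sup>2)"
    unfolding sum_distrib_right[symmetric] sum.distrib[symmetric] by (intro sum.cong) auto
  also have "\<dots> \<le> (\<Sum>x\<in>D. ?N * (g x)\<^sup>2)"
    using row by (intro sum_mono mult_right_mono) auto
  finally have 1: "(\<Sum>x\<in>D. \<Sum>y\<in>D. ?A x y * (g x * g y)) \<le> (\<Sum>x\<in>D. ?N * (g x)\<^sup>2)" .
  have "ip D g (kapp (dker V) D g) = (\<Sum>x\<in>D. (\<Sum>y\<in>D. ?A x y * (g x * g y)) + (V x - ?N) * (g x)\<^sup>2)"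
    unfolding ip_def
  proof (intro sum.cong refl)
    fix x assume x: "x \<in> D"
    have "(\<Sum>y\<in>D \<inter> {y. lnorm (y - x) = 1}. g y) = (\<Sum>y\<in>D. ?A x y * g y)"
      using assms by (simp add: sum.inter_restrict) (intro sum.cong, auto)
    then have "kapp (dker V) D g x = (\<Sum>y\<in>D. ?A x y * g y) + (V x - ?N) * g x"
      using assms x by (simp add: kapp_dker)
    then show "g x * kapp (dker V) D g x = (\<Sum>y\<in>D. ?A x y * (g x * g y)) + (V x - ?N) * (g x)\<^sup>2"
      by (simp only: distrib_left sum_distrib_left power2_eq_square mult_ac)
  qed
  also have "\<dots> = (\<Sum>x\<in>D. \<Sum>y\<in>D. ?A x y * (g x * g y)) + (\<Sum>x\<in>D. (V x - ?N) * (g x)\<^sup>2)"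
    by (rule sum.distrib)
  also have "(\<Sum>x\<in>D. (V x - ?N) * (g x)\<^sup>2) = (\<Sum>x\<in>D. V x * (g x)\<^sup>2) - (\<Sum>x\<in>D. ?N * (g x)\<^sup>2)"
    by (simp only: left_diff_distrib sum_subtractf)
  finally show ?thesis using 1 by linarith
qed

lemma is_eigpair_iff_kapp:
  assumes "finite D"
  shows "is_eigpair D V lam f \<longleftrightarrow> (\<forall>x. x \<notin> D \<longrightarrow> f x = 0) \<and> ip D f f \<noteq> 0
    \<and> (\<forall>x\<in>D. kapp (dker V) D f x = lam * f x)"
  using assms by (auto simp: is_eigpair_def dir_op_eq_kapp ip_self_eq_0_iff)

text \<open>\<open>princ_eigval\<close> is a \<open>Max\<close>, which has its intended meaning only
  on a finite nonempty set. Orthogonality bounds the number of eigenvalues, and the variational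
  maximum is one of them and dominates the others.\<close>

lemma princ_eigval_top:
  fixes D :: "(int^'d) set"
  assumes fin: "finite D" and ne: "D \<noteq> {}"
  shows "\<exists>u. ip D u u = 1 \<and> (\<forall>x\<in>D. kapp (dker V) D u x = princ_eigval D V * u x)"
    and "ip D g (kapp (dker V) D g) \<le> princ_eigval D V * ip D g g"
proof -
  obtain lam u where u: "\<And>x. x \<notin> D \<Longrightarrow> u x = 0" "ip D u u = 1"
    "\<And>x. x \<in> D \<Longrightarrow> kapp (dker V) D u x = lam * u x"
    and top: "\<And>g. ip D g (kapp (dker V) D g) \<le> lam * ip D g g"
    using top_eigenvector_exists[OF fin ne sym_kernel_dker] by metis
  let ?E = "{lam. \<exists>f. is_eigpair D V lam f}"
  have "finite ?E"
  proof -
    have "card T \<le> card D" if "T \<subseteq> ?E" "finite T" for T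
    proof (rule card_eigenvalues_le[OF fin sym_kernel_dker[of V D] \<open>finite T\<close>])
      fix mu assume "mu \<in> T"
      then obtain f where "is_eigpair D V mu f" using \<open>T \<subseteq> ?E\<close> by auto
      then show "\<exists>f. ip D f f \<noteq> 0 \<and> (\<forall>x\<in>D. kapp (dker V) D f x = mu * f x)"
        by (auto simp: is_eigpair_iff_kapp[OF fin])
    qed
    then show ?thesis using finite_if_finite_subsets_card_bdd by blast
  qed
  moreover have "lam \<in> ?E" using u by (auto simp: is_eigpair_iff_kapp[OF fin] intro!: exI[of _ u])
  moreover have "mu \<le> lam" if "mu \<in> ?E" for mu
  proof -
    obtain f where "is_eigpair D V mu f" using \<open>mu \<in> ?E\<close> by auto
    then have f: "ip D f f \<noteq> 0" "\<forall>x\<in>D. kapp (dker V) D f x = mu * f x"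
      by (auto simp: is_eigpair_iff_kapp[OF fin])
    then have "mu * ip D f f \<le> lam * ip D f f"
      using top[of f] by (simp add: ip_scale_right cong: ip_cong)
    then show ?thesis using f(1) ip_self_nonneg[of D f] by (simp add: mult_le_cancel_right)
  qed
  ultimately have eq: "princ_eigval D V = lam" unfolding princ_eigval_def by (intro Max_eqI) auto
  show "\<exists>u. ip D u u = 1 \<and> (\<forall>x\<in>D. kapp (dker V) D u x = princ_eigval D V * u x)"
    using u eq by auto
  show "ip D g (kapp (dker V) D g) \<le> princ_eigval D V * ip D g g" using top eq by simp
qed

text \<open>Test with the point mass at \<open>x\<close>.\<close>

lemma princ_eigval_lower:
  fixes D :: "(int^'d) set"
  assumes "finite D" "x \<in> D"
  shows "V x - real (card (nbhd0 :: (int^'d) set)) \<le> princ_eigval D V"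
  using princ_eigval_top(2)[of D "\<lambda>y. if y = x then 1 else 0" V] assms
    ip_dker_delta[OF assms, of V] ip_delta[OF assms, of "\<lambda>y. if y = x then 1 else 0"] by auto

section \<open>Decay of the principal eigenfunction and the trial function estimate\<close>

lemma princ_efun_unit: "is_princ_efun D V f \<Longrightarrow> ip D f f = 1"
  by (simp add: is_princ_efun_def ip_def power2_eq_square)

lemma princ_efun_eigen:
  "finite D \<Longrightarrow> is_princ_efun D V f \<Longrightarrow> x \<in> D \<Longrightarrow> kapp (dker V) D f x = princ_eigval D V * f x"
  by (simp add: is_princ_efun_def is_eigpair_iff_kapp)

lemma princ_efun_outside: "is_princ_efun D V f \<Longrightarrow> x \<notin> D \<Longrightarrow> f x = 0"
  by (simp add: is_princ_efun_def is_eigpair_def)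

lemma princ_efun_nonempty: "is_princ_efun D V f \<Longrightarrow> D \<noteq> {}"
  by (auto simp: is_princ_efun_def)

lemma princ_eigval_nonpos:
  assumes fin: "finite D" and f: "is_princ_efun D V f" and V: "\<And>x. x \<in> D \<Longrightarrow> V x \<le> 0"
  shows "princ_eigval D V \<le> 0"
proof -
  have "princ_eigval D V = ip D f (kapp (dker V) D f)"
    using princ_efun_eigen[OF fin f] princ_efun_unit[OF f] by (simp add: ip_scale_right cong: ip_cong)
  also have "\<dots> \<le> (\<Sum>x\<in>D. V x * (f x)\<^sup>2)" by (rule ip_dker_le_potential[OF fin])
  also have "\<dots> \<le> 0" using V by (intro sum_nonpos mult_nonpos_nonneg) auto
  finally show ?thesis .
qed

lemma sum_neighbours_le:
  fixes D :: "(int^'d) set"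
  assumes "\<And>y. y \<in> D \<Longrightarrow> lnorm (y - x) = 1 \<Longrightarrow> f y \<le> B" "0 \<le> B"
  shows "(\<Sum>y\<in>D \<inter> {y. lnorm (y - x) = 1}. f y) \<le> real (card (nbhd0 :: (int^'d) set)) * B"
proof -
  have "(\<Sum>y\<in>D \<inter> {y. lnorm (y - x) = 1}. f y) \<le> real (card (D \<inter> {y. lnorm (y - x) = 1})) * B"
    using assms by (intro sum_bounded_above) auto
  also have "\<dots> \<le> real (card (nbhd0 :: (int^'d) set)) * B"
    using assms card_mono[OF finite_neighbours[of x], of "D \<inter> {y. lnorm (y - x) = 1}"]
    by (intro mult_right_mono) (auto simp: card_neighbours)
  finally show ?thesis .
qed

text \<open>Solve the eigenvalue equation at x for f(x). The coefficient
  \<open>princ_eigval D V + N - V x\<close> is at least m, because the point mass at 0 shows that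
  the eigenvalue is at least -N, while the other side is a sum over at most N neighbours; so each
  step gains N / m. The hypothesis is \<open>n \<le> l1 x\<close> rather than equality so that the
  induction also covers neighbours farther out than x.\<close>

lemma princ_efun_decay:
  fixes D :: "(int^'d) set"
  assumes fin: "finite D" and D0: "0 \<in> D" and f: "is_princ_efun D V f"
    and V0: "V 0 = 0" and V: "\<And>x. x \<in> D \<Longrightarrow> x \<noteq> 0 \<Longrightarrow> V x \<le> - m" and m: "0 < m"
  shows "n \<le> l1 x \<Longrightarrow> f x \<le> (real (card (nbhd0 :: (int^'d) set)) / m) ^ n"
proof (induction n arbitrary: x)
  case 0
  show ?case
  proof (cases "x \<in> D")
    case True
    have "f x * f x \<le> ip D f f" unfolding ip_def using True fin by (intro member_le_sum) auto
    then have "\<bar>f x\<bar> \<le> 1" using princ_efun_unit[OF f] by (simp add: abs_square_le_1 flip: power2_eq_square)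
    then show ?thesis by simp
  qed (use princ_efun_outside[OF f] in auto)
next
  case (Suc n)
  let ?N = "real (card (nbhd0 :: (int^'d) set))"
  let ?q = "?N / m"
  have q0: "0 \<le> ?q" using m by simp
  have f0: "0 \<le> f y" for y using f by (simp add: is_princ_efun_def)
  show ?case
  proof (cases "x \<in> D")
    case True
    have x: "x \<noteq> 0" using Suc.prems l1_eq_0_iff[of x] by auto
    have lam: "- ?N \<le> princ_eigval D V" using princ_eigval_lower[OF fin D0, of V] V0 by simp
    have "m * f x \<le> (princ_eigval D V + ?N - V x) * f x"
      using lam V[OF True x] f0 by (intro mult_right_mono) auto
    also have "\<dots> = (\<Sum>y\<in>D \<inter> {y. lnorm (y - x) = 1}. f y)"
      using princ_efun_eigen[OF fin f True] kapp_dker[OF fin True, of V f] by (simp add: algebra_simps)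
    also have "\<dots> \<le> ?N * ?q ^ n"
    proof (rule sum_neighbours_le)
      fix y assume "lnorm (y - x) = 1"
      then have "l1 x \<le> Suc (l1 y)" by (rule l1_le_Suc_of_neighbour)
      then show "f y \<le> ?q ^ n" using Suc by simp
    qed (use q0 in auto)
    finally show ?thesis using m by (simp add: field_simps)
  next
    case False
    then show ?thesis using princ_efun_outside[OF f] zero_le_power[OF q0, of "Suc n"] by simp
  qed
qed

text \<open>The hypothesis on p makes p^2 at most half the summable ratio b. The spare factor
  2^(-l1) is turned into 2 / A on the far set. The exponent is l1 - 1 because outside the small box
  the residual at a site is fed by neighbours possibly one step nearer to the origin.\<close>

lemma sum_power_l1_far_le:
  fixes F :: "(int^'d) set"
  assumes fin: "finite F" and far: "\<And>z. z \<in> F \<Longrightarrow> A / 2 < real (l1 z)" and A: "0 < A"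
    and p: "0 \<le> p" "4 * real (card (nbhd0 :: (int^'d) set)) * p\<^sup>2 \<le> 1"
  shows "(\<Sum>z\<in>F. (p ^ (l1 z - 1))\<^sup>2) \<le> 16 * real (card (nbhd0 :: (int^'d) set)) / A"
proof -
  define b where "b = 1 / (2 * real (card (nbhd0 :: (int^'d) set)))"
  have b: "0 < b" "p\<^sup>2 \<le> b / 2" using p card_nbhd0_pos[where 'd = 'd] by (auto simp: b_def field_simps)
  have "(\<Sum>z\<in>F. (p ^ (l1 z - 1))\<^sup>2) \<le> (\<Sum>z\<in>F. (4 / (b * A)) * b ^ l1 z)"
  proof (intro sum_mono)
    fix z assume z: "z \<in> F"
    have "l1 z \<noteq> 0" using far[OF z] A by auto
    then obtain n where n: "l1 z = Suc n" by (cases "l1 z") auto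
    have "(p ^ (l1 z - 1))\<^sup>2 = (p\<^sup>2) ^ n" by (simp add: n power_mult[symmetric] mult.commute)
    also have "\<dots> \<le> (b / 2) ^ n" using b by (intro power_mono) auto
    also have "\<dots> = (2 / b) * b ^ l1 z * (1 / 2 ^ l1 z)" using b by (simp add: n power_divide)
    also have "\<dots> \<le> (2 / b) * b ^ l1 z * (2 / A)"
    proof (intro mult_left_mono)
      have "real (l1 z) < 2 ^ l1 z" by (rule of_nat_less_two_power)
      then have "A / 2 < 2 ^ l1 z" using far[OF z] by linarith
      then show "1 / 2 ^ l1 z \<le> 2 / A" using A by (simp add: field_simps)
    qed (use b in auto)
    finally show "(p ^ (l1 z - 1))\<^sup>2 \<le> (4 / (b * A)) * b ^ l1 z" by (simp add: field_simps)
  qed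
  also have "\<dots> = (4 / (b * A)) * (\<Sum>z\<in>F. b ^ l1 z)" by (simp add: sum_distrib_left)
  also have "\<dots> \<le> (4 / (b * A)) * 2"
    using sum_power_l1_le[OF fin] b A by (intro mult_left_mono) (auto simp: b_def)
  finally show ?thesis by (simp add: b_def field_simps)
qed

text \<open>Here \<open>U\<close> is the model potential on the small domain and \<open>V\<close>
  the true one on the large domain. The residual of f is (V - U) f inside \<open>D0\<close> and the
  flux from \<open>D0\<close> outside, so \<open>P\<close> bounds its squared norm, and the Rayleigh
  quotient exceeds the model eigenvalue by the sum of f^2 (V - U).\<close>

lemma local_trial_function_bounds:
  fixes D D0 :: "(int^'d) set"
  defines "N \<equiv> real (card (nbhd0 :: (int^'d) set))"
  assumes fin: "finite D" and sub: "D0 \<subseteq> D" and zero: "0 \<in> D0"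
    and V0: "V 0 = 0" and U0: "U 0 = 0"
    and V: "\<And>z. z \<in> D \<Longrightarrow> z \<noteq> 0 \<Longrightarrow> V z \<le> - G" and G: "4 * N \<le> G"
    and U: "\<And>z. z \<in> D0 \<Longrightarrow> z \<noteq> 0 \<Longrightarrow> U z \<le> - m" and m: "0 < m" "4 * N * (N / m)\<^sup>2 \<le> 1"
    and f: "is_princ_efun D0 U f"
    and far: "\<And>z. z \<in> D - D0 \<Longrightarrow> A / 2 < real (l1 z)" and A: "0 < A"
    and phi: "ip D \<phi> \<phi> = 1" "\<And>x. x \<in> D \<Longrightarrow> kapp (dker V) D \<phi> x = lam * \<phi> x" "- N \<le> lam"
  defines "P \<equiv> (\<Sum>z\<in>D0. (f z)\<^sup>2 * (V z - U z)\<^sup>2) + 16 * N ^ 3 / A"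
  shows "1 - (ip D \<phi> f)\<^sup>2 \<le> 9 * P / G\<^sup>2"
    and "\<bar>lam - princ_eigval D0 U - (\<Sum>z\<in>D0. (f z)\<^sup>2 * (V z - U z))\<bar> \<le> 6 * P / G"
proof -
  have fin0: "finite D0" using fin sub by (rule finite_subset[rotated])
  have Npos: "0 < N" unfolding N_def using card_nbhd0_pos by simp
  have Gpos: "0 < G" using Npos G by simp
  define mu where "mu = princ_eigval D0 U"
  have mu: "- N \<le> mu" "mu \<le> 0"
    using princ_eigval_lower[OF fin0 zero, of U] U0 princ_eigval_nonpos[OF fin0 f] U m
    unfolding mu_def N_def by (force, smt (verit, best))
  have out: "f z = 0" if "z \<notin> D0" for z using princ_efun_outside[OF f that] .
  have restrict: "(\<Sum>z\<in>D. f z * g z) = (\<Sum>z\<in>D0. f z * g z)" for g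
    using fin sub out by (intro sum.mono_neutral_right) auto
  define \<rho> where "\<rho> = (\<lambda>x. kapp (dker V) D f x - mu * f x)"
  have nb: "(\<Sum>y\<in>D \<inter> {y. lnorm (y - x) = 1}. f y) = (\<Sum>y\<in>D0 \<inter> {y. lnorm (y - x) = 1}. f y)" for x
    using fin sub out by (intro sum.mono_neutral_right) auto
  have rho_in: "\<rho> x = (V x - U x) * f x" if "x \<in> D0" for x
    using princ_efun_eigen[OF fin0 f that] kapp_dker[OF fin0 that, of U f] that sub
    by (auto simp: \<rho>_def kapp_dker[OF fin] nb mu_def algebra_simps)
  have rho_out: "\<rho> x = (\<Sum>y\<in>D \<inter> {y. lnorm (y - x) = 1}. f y)" if "x \<in> D - D0" for x
    using that out by (simp add: \<rho>_def kapp_dker[OF fin])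
  have rho_out_le: "\<bar>\<rho> x\<bar> \<le> N * (N / m) ^ (l1 x - 1)" if x: "x \<in> D - D0" for x
  proof -
    have "0 \<le> \<rho> x" unfolding rho_out[OF x] using f by (intro sum_nonneg) (simp add: is_princ_efun_def)
    moreover have "\<rho> x \<le> N * (N / m) ^ (l1 x - 1)"
      unfolding rho_out[OF x] N_def
    proof (rule sum_neighbours_le)
      fix y assume "lnorm (y - x) = 1"
      then have "l1 x - 1 \<le> l1 y" using l1_le_Suc_of_neighbour[of y x] by simp
      then show "f y \<le> (real (card (nbhd0 :: (int^'d) set)) / m) ^ (l1 x - 1)"
        by (intro princ_efun_decay[where V = U, OF fin0 zero f U0 _ m(1)] U)
    qed (use m in auto)
    ultimately show ?thesis by simp
  qed
  have "ip D \<rho> \<rho> = (\<Sum>x\<in>D0. \<rho> x * \<rho> x) + (\<Sum>x\<in>D - D0. \<rho> x * \<rho> x)"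
    unfolding ip_def using sum.subset_diff[OF sub fin, of "\<lambda>x. \<rho> x * \<rho> x"] by simp
  also have "(\<Sum>x\<in>D0. \<rho> x * \<rho> x) = (\<Sum>z\<in>D0. (f z)\<^sup>2 * (V z - U z)\<^sup>2)"
    using rho_in by (intro sum.cong) (auto simp: power2_eq_square)
  also have "(\<Sum>x\<in>D - D0. \<rho> x * \<rho> x) \<le> (\<Sum>x\<in>D - D0. N\<^sup>2 * ((N / m) ^ (l1 x - 1))\<^sup>2)"
  proof (intro sum_mono)
    fix x assume "x \<in> D - D0"
    then have "\<bar>\<rho> x\<bar>\<^sup>2 \<le> (N * (N / m) ^ (l1 x - 1))\<^sup>2" using rho_out_le by (intro power_mono) auto
    then show "\<rho> x * \<rho> x \<le> N\<^sup>2 * ((N / m) ^ (l1 x - 1))\<^sup>2"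
      by (simp add: power2_eq_square mult_ac)
  qed
  also have "\<dots> \<le> N\<^sup>2 * (16 * N / A)"
    unfolding sum_distrib_left[symmetric] using sum_power_l1_far_le[of "D - D0" A "N / m"] fin far A m Npos
    by (intro mult_left_mono) (auto simp: N_def)
  finally have PP: "ip D \<rho> \<rho> \<le> P" by (simp add: P_def power2_eq_square power3_eq_cube mult_ac)
  \<comment> \<open>Discard the nonpositive Laplacian; the potential alone is below -G at every site
    but the origin.\<close>
  have gap: "ip D g (kapp (dker V) D g) \<le> - G * (ip D g g - (g 0)\<^sup>2)" for g
  proof -
    have 0: "0 \<in> D" using zero sub by auto
    have "ip D g (kapp (dker V) D g) \<le> (\<Sum>x\<in>D. V x * (g x)\<^sup>2)" by (rule ip_dker_le_potential[OF fin])
    also have "\<dots> = (\<Sum>x\<in>D - {0}. V x * (g x)\<^sup>2)"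
      using sum.remove[OF fin 0, of "\<lambda>x. V x * (g x)\<^sup>2"] V0 by simp
    also have "\<dots> \<le> (\<Sum>x\<in>D - {0}. - G * (g x)\<^sup>2)" using V by (intro sum_mono mult_right_mono) auto
    also have "\<dots> = - G * (ip D g g - (g 0)\<^sup>2)"
      using sum.remove[OF fin 0, of "\<lambda>x. (g x)\<^sup>2"]
      by (simp add: ip_def sum_distrib_left sum_negf power2_eq_square flip: sum_distrib_left)
    finally show ?thesis .
  qed
  have unit: "ip D f f = 1" using princ_efun_unit[OF f] restrict[of f] by (simp add: ip_def)
  have 0: "0 \<in> D" using zero sub by auto
  note bnds = rayleigh_residual_bounds[OF fin sym_kernel_dker 0 gap Npos G phi(1) phi(2) phi(3) unit mu, of \<rho>]
  show "1 - (ip D \<phi> f)\<^sup>2 \<le> 9 * P / G\<^sup>2"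
    using bnds(1) PP by (simp add: \<rho>_def) (smt (verit) divide_right_mono zero_le_power2)
  have "ip D f (kapp (dker V) D f) = ip D f \<rho> + mu"
    unfolding \<rho>_def ip_linear using unit by simp
  also have "ip D f \<rho> = (\<Sum>z\<in>D0. (f z)\<^sup>2 * (V z - U z))"
    unfolding ip_def restrict using rho_in by (intro sum.cong) (auto simp: power2_eq_square)
  finally have "\<bar>lam - princ_eigval D0 U - (\<Sum>z\<in>D0. (f z)\<^sup>2 * (V z - U z))\<bar> \<le> 6 * ip D \<rho> \<rho> / G"
    using bnds(2) by (simp add: \<rho>_def mu_def algebra_simps)
  also have "\<dots> \<le> 6 * P / G" using PP Gpos by (intro divide_right_mono) auto
  finally show "\<bar>lam - princ_eigval D0 U - (\<Sum>z\<in>D0. (f z)\<^sup>2 * (V z - U z))\<bar> \<le> 6 * P / G" .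
qed

section \<open>Translation, boxes and weighted sums\<close>

lemma ip_translate: "ip D f g = ip ((\<lambda>x. x - t) ` D) (\<lambda>z. f (t + z)) (\<lambda>z. g (t + z))"
  for t :: "'a :: ab_group_add"
  unfolding ip_def by (subst sum.reindex) (auto simp: inj_on_def)

lemma kapp_dker_translate:
  "kapp (dker V) D f (t + z)
    = kapp (dker (\<lambda>z. V (t + z))) ((\<lambda>x. x - t) ` D) (\<lambda>z. f (t + z)) z"
proof -
  have "dker V (t + z) y = dker (\<lambda>z. V (t + z)) z (y - t)" for y
    by (auto simp: dker_def diff_diff_eq)
  then show ?thesis unfolding kapp_def by (subst sum.reindex) (auto simp: inj_on_def)
qed

lemma Qbox_iff_abs: "x \<in> Qbox s \<longleftrightarrow> (\<forall>i. \<bar>real_of_int (x $ i)\<bar> \<le> s / 2)"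
proof -
  have "- s / 2 \<le> y \<and> y \<le> s / 2 \<longleftrightarrow> \<bar>y\<bar> \<le> s / 2" for y :: real by linarith
  then show ?thesis by (simp only: Qbox_def mem_Collect_eq)
qed

lemma Qbox_mono: "s \<le> t \<Longrightarrow> Qbox s \<subseteq> Qbox t"
  unfolding Qbox_iff_abs subset_iff by (meson divide_right_mono order_trans zero_le_numeral)

lemma Qbox_nonneg: "x \<in> Qbox s \<Longrightarrow> 0 \<le> s"
  unfolding Qbox_iff_abs by (meson abs_ge_zero order_trans zero_le_divide_iff not_le zero_less_numeral)

lemma Qbox_add:
  assumes "x \<in> Qbox s" "y \<in> Qbox t" shows "x + y \<in> Qbox (s + t)" "x - y \<in> Qbox (s + t)"
proof -
  have *: "\<bar>real_of_int (x $ i)\<bar> \<le> s / 2" "\<bar>real_of_int (y $ i)\<bar> \<le> t / 2" for i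
    using assms by (auto simp: Qbox_iff_abs)
  have "\<bar>real_of_int (x $ i) + real_of_int (y $ i)\<bar> \<le> (s + t) / 2" for i
    using *[of i] by (simp add: add_divide_distrib)
  then show "x + y \<in> Qbox (s + t)" by (simp add: Qbox_iff_abs)
  have "\<bar>real_of_int (x $ i) - real_of_int (y $ i)\<bar> \<le> (s + t) / 2" for i
    using *[of i] by (simp add: add_divide_distrib)
  then show "x - y \<in> Qbox (s + t)" by (simp add: Qbox_iff_abs)
qed

text \<open>Growth is given in the Euclidean norm and decay in the graph norm. As the former norm is
  the smaller one and the base is at least 1, both can be compared step by step.\<close>

lemma exp_powr_lnorm_le:
  assumes "1 \<le> B" "0 \<le> s" "0 \<le> c"
  shows "exp (c * lnorm z) * B powr (s * lnorm z) \<le> (exp c * B powr s) ^ l1 z"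
proof -
  have "exp (c * lnorm z) * B powr (s * lnorm z) \<le> exp (c * real (l1 z)) * B powr (s * real (l1 z))"
    using assms lnorm_le_l1[of z] lnorm_nonneg[of z] by (intro mult_mono powr_mono) (auto intro: mult_left_mono)
  also have "\<dots> = (exp c * B powr s) ^ l1 z"
    using assms by (simp add: power_mult_distrib powr_powr[symmetric] powr_realpow exp_of_nat2_mult)
  finally show ?thesis .
qed

text \<open>Decay of f^2 against growth of g. Since g vanishes at the origin, where f has most of
  its mass, the sum starts with the first sphere and gains a full factor p^2 t.\<close>

lemma weighted_sum_le:
  fixes D0 :: "(int^'d) set" and t :: real
  defines "N \<equiv> real (card (nbhd0 :: (int^'d) set))"
  assumes fin: "finite D0" and p: "0 \<le> p" and t: "0 \<le> t" and B: "0 \<le> B"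
    and f: "\<And>z. \<bar>f z\<bar> \<le> p ^ l1 z"
    and g: "\<And>z. z \<in> D0 \<Longrightarrow> z \<noteq> 0 \<Longrightarrow> \<bar>g z\<bar> \<le> B * t ^ l1 z" and g0: "g 0 = 0"
    and small: "2 * N * (p\<^sup>2 * t) \<le> 1"
  shows "\<bar>\<Sum>z\<in>D0. (f z)\<^sup>2 * g z\<bar> \<le> B * (4 * N * (p\<^sup>2 * t))"
proof -
  have "(\<Sum>z\<in>D0. (f z)\<^sup>2 * g z) = (\<Sum>z\<in>D0 - {0}. (f z)\<^sup>2 * g z)"
    using fin g0 by (intro sum.mono_neutral_right) auto
  also have "\<bar>\<dots>\<bar> \<le> (\<Sum>z\<in>D0 - {0}. B * (p\<^sup>2 * t) ^ l1 z)"
  proof (intro order_trans[OF sum_abs] sum_mono)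
    fix z assume z: "z \<in> D0 - {0}"
    have "\<bar>f z\<bar>\<^sup>2 \<le> (p ^ l1 z)\<^sup>2" using f by (intro power_mono) auto
    then have "(f z)\<^sup>2 \<le> (p\<^sup>2) ^ l1 z" by (simp add: power_mult[symmetric] mult.commute)
    then have "(f z)\<^sup>2 * \<bar>g z\<bar> \<le> (p\<^sup>2) ^ l1 z * (B * t ^ l1 z)"
      using g z by (intro mult_mono) auto
    then show "\<bar>(f z)\<^sup>2 * g z\<bar> \<le> B * (p\<^sup>2 * t) ^ l1 z"
      by (simp add: abs_mult power_mult_distrib mult_ac)
  qed
  also have "\<dots> \<le> B * (4 * N * (p\<^sup>2 * t))"
    unfolding sum_distrib_left[symmetric] using small fin t B sum_power_l1_off_origin_le[of "D0 - {0}" "p\<^sup>2 * t"]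
    by (intro mult_left_mono) (auto simp: N_def)
  finally show ?thesis .
qed

text \<open>The deterministic estimate at a fixed scale. \<open>s1\<close> makes the gap at least
  4N, \<open>s2\<close> keeps the deviation of \<xi>(x0) from a below a/10, \<open>s3\<close> makes
  the residual outside the small box summable, and \<open>s4\<close> makes the weighted series
  converge. The third part of the event appears with its variance evaluated and multiplied
  out.\<close>

lemma localisation_at_scale:
  fixes v \<xi> phib :: "int^'d \<Rightarrow> real" and a d r R c c' \<kappa> \<theta> :: real and x0 :: "int^'d"
  defines "N \<equiv> real (card (nbhd0 :: (int^'d) set))"
  assumes pos: "0 < d" "0 < a" "d \<le> a" "0 < c" "0 < c'" "0 \<le> \<theta>" "0 < \<kappa>" "\<kappa> < 1/3"
    and v0: "v 0 = 1" and v_nonneg: "\<And>z. 0 \<le> v z"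
    and v_low: "\<And>z. z \<noteq> 0 \<Longrightarrow> 1 - exp (c' * lnorm z) / d \<le> v z"
    and v_up: "\<And>z. z \<noteq> 0 \<Longrightarrow> v z \<le> 1 - c / d"
    and s1: "5 * N * d \<le> c * a"
    and s2: "10 * \<theta> \<le> a"
    and s3: "4 * N * (N * d / (c * a))\<^sup>2 \<le> 1"
    and s4: "2 * N * ((N / c)\<^sup>2 * exp c' * (d / a) powr (2 - 2 * \<kappa>)) \<le> 1"
    and ar: "a \<le> r"
    and phib: "is_princ_efun (Qbox r) (\<lambda>x. - Sfun a v x) phib"
    and x0: "x0 \<in> Qbox (R - r)"
    and E1: "\<bar>\<xi> x0 - a\<bar> \<le> \<theta>"
    and E2: "\<And>x. x \<in> Qbox_at (2 * R) x0 \<Longrightarrow> \<bar>zeta v \<xi> x0 x\<bar> \<le> Sfun a v (x - x0) / 10"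
    and E3: "\<And>x. x \<in> Qbox_at R x0 \<Longrightarrow> x \<noteq> x0 \<Longrightarrow> \<bar>zeta v \<xi> x0 x\<bar>
       \<le> sqrt (1 - v (x - x0) * v (x0 - x))
          * ((a / d) powr (\<kappa> * lnorm (x - x0)) * sqrt (max 1 (\<bar>\<xi> x0 - a\<bar> * a)))"
  defines "\<delta> \<equiv> (d / a) powr (1 - 2 * \<kappa>) * \<bar>\<xi> x0 - a\<bar> + 1 / a"
  defines "C2 \<equiv> (2 * \<theta>\<^sup>2 + 4) * 4 * N ^ 3 * exp c' / c\<^sup>2 + 16 * N ^ 3"
    and "C3 \<equiv> 4 * N ^ 3 * \<theta> * exp c' / c\<^sup>2"
  shows "\<bar>princ_eigval (Qbox R) \<xi> - princ_eigval (Qbox r) (\<lambda>x. - Sfun a v x) - Xi r phib v \<xi> x0\<bar>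
      \<le> (15 * C2 / (2 * c) + C3) * (d / a) * \<delta>"
    and "is_princ_efun (Qbox R) \<xi> \<phi> \<Longrightarrow>
      sqrt (\<Sum>x\<in>Qbox R. (\<phi> x - phib (x - x0))\<^sup>2) \<le> sqrt (30 * C2) / c * (d / a) * sqrt \<delta>"
proof -
  define D where "D = (\<lambda>x. x - x0) ` Qbox R"
  define D0 where "D0 = (Qbox r :: (int^'d) set)"
  define V where "V = (\<lambda>z. \<xi> (x0 + z) - \<xi> x0)"
  define U where "U = (\<lambda>z. - Sfun a v z)"
  define \<eta> where "\<eta> = \<xi> x0 - a"
  define Z where "Z = (\<lambda>z. zeta v \<xi> x0 (x0 + z))"
  \<comment> \<open>Growth per lattice step of the squared bound on zeta: \<open>exp c'\<close> from
    its variance and the power of a/d from the event.\<close>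
  define t where "t = exp c' * (a / d) powr (2 * \<kappa>)"
  define p where "p = N * d / (c * a)"
  define m where "m = c * a / d"
  define G where "G = 4 / 5 * m"
  have Npos: "0 < N" unfolding N_def using card_nbhd0_pos by simp
  have pm: "p = N / m" by (simp add: p_def m_def)
  have m: "0 < m" using pos by (simp add: m_def)
  have r: "0 < r" using ar pos by simp
  have R: "0 \<le> R" "0 \<le> R - r" using Qbox_nonneg[OF x0] r by auto
  have finD: "finite D" "finite D0" by (simp_all add: D_def D0_def finite_Qbox)
  have D_iff: "z \<in> D \<longleftrightarrow> x0 + z \<in> Qbox R" for z
    by (auto simp: D_def image_iff) (metis add_diff_cancel_left')
  have sub: "D0 \<subseteq> D"
    using Qbox_add(1)[OF x0, of _ r] by (auto simp: D_iff D0_def)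
  have Qmono: "z \<in> Qbox R" if "z \<in> D0" for z
    using that R Qbox_mono[of r R] by (auto simp: D0_def)
  have x0R: "x0 \<in> Qbox R" using x0 r Qbox_mono[of "R - r" R] by auto
  have zero: "0 \<in> D0" using r by (simp add: D0_def Qbox_iff_abs)
  have w0: "c / d \<le> 1 - v z" "1 - v z \<le> exp (c' * lnorm z) / d" "1 - v z \<le> 1" "0 \<le> 1 - v z"
    if "z \<noteq> 0" for z
    using v_low[OF that] v_up[OF that] v_nonneg[of z] divide_pos_pos[OF pos(4,1)] by linarith+
  have ad1: "1 \<le> a / d" using pos by simp
  have "exp (c' * lnorm z) * 1 \<le> exp (c' * lnorm z) * (a / d) powr (2 * \<kappa> * lnorm z)" for z :: "int^'d"
    using pos ad1 lnorm_nonneg[of z] by (intro mult_left_mono ge_one_powr_ge_zero) auto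
  with exp_powr_lnorm_le[of "a / d" "2 * \<kappa>" c'] have expt1: "exp (c' * lnorm z) \<le> t ^ l1 z" for z :: "int^'d"
    using pos ad1 unfolding t_def by (smt (verit, best))
  have expt: "exp (c' * lnorm z) * (a / d) powr (2 * \<kappa> * lnorm z) \<le> t ^ l1 z" for z :: "int^'d"
    using exp_powr_lnorm_le[of "a / d" "2 * \<kappa>" c' z] pos ad1 by (simp add: t_def)
  have t0: "0 < t" unfolding t_def using pos by simp
  \<comment> \<open>The perturbation has two sources: the field fluctuation \<open>Z\<close> and the
    deviation \<eta> of the peak height from a.\<close>
  have VU: "V z - U z = Z z - \<eta> * (1 - v z)" for z
    by (simp add: V_def U_def Z_def zeta_def Sfun_def \<eta>_def algebra_simps)
  have Z0: "Z 0 = 0" by (simp add: Z_def zeta_def v0)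
  have V0: "V 0 = 0" "U 0 = 0" by (simp_all add: V_def U_def Sfun_def v0)

  have m_le: "m \<le> a * (1 - v z)" if "z \<noteq> 0" for z
    using mult_left_mono[OF w0(1)[OF that], of a] pos by (simp add: m_def mult_ac)
  have V_le: "V z \<le> - G" if z: "z \<in> D" "z \<noteq> 0" for z
  proof -
    \<comment> \<open>Seen from x0, the large box is not centred but lies in the centred box of
      twice the side; hence the radius 2R in the second part of the event.\<close>
    have "z \<in> Qbox (2 * R)"
      using Qbox_add(2)[OF _ x0R, of "x0 + z" R] z by (simp add: D_iff)
    then have "x0 + z \<in> Qbox_at (2 * R) x0" by (simp add: Qbox_at_def)
    then have "\<bar>Z z\<bar> \<le> a * (1 - v z) / 10" using E2[of "x0 + z"] by (simp add: Z_def Sfun_def)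
    moreover have "\<bar>\<eta> * (1 - v z)\<bar> \<le> a / 10 * (1 - v z)"
      unfolding abs_mult using E1 s2 w0[OF z(2)] by (intro mult_mono) (auto simp: \<eta>_def)
    moreover have "V z = - (a * (1 - v z)) + Z z - \<eta> * (1 - v z)"
      using VU[of z] by (simp add: U_def Sfun_def)
    ultimately have "V z \<le> - (4 / 5 * (a * (1 - v z)))" by linarith
    also have "\<dots> \<le> - G" using m_le[OF z(2)] unfolding G_def by linarith
    finally show ?thesis .
  qed
  have U_le: "U z \<le> - m" if "z \<noteq> 0" for z
    using m_le[OF that] by (simp add: U_def Sfun_def)
  have G4: "4 * N \<le> G" using s1 pos by (simp add: G_def m_def field_simps)
  have Gpos: "0 < G" using G4 Npos by simp
  have f: "is_princ_efun D0 U phib" using phib by (simp add: D0_def U_def)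
  have decay: "\<bar>phib z\<bar> \<le> p ^ l1 z" for z
    using princ_efun_decay[OF finD(2) zero f V0(2) U_le m, of "l1 z" z] f
    by (simp add: pm N_def is_princ_efun_def)
  have p0: "0 \<le> p" using pos Npos by (simp add: p_def)
  have p2t: "p\<^sup>2 * t = (N / c)\<^sup>2 * exp c' * (d / a) powr (2 - 2 * \<kappa>)"
  proof -
    have "(a / d) powr (2 * \<kappa>) = (d / a) powr (- (2 * \<kappa>))" using pos by (simp add: powr_minus powr_divide)
    moreover have "(d / a)\<^sup>2 * (d / a) powr (- (2 * \<kappa>)) = (d / a) powr (2 - 2 * \<kappa>)"
      using pos by (simp add: powr_add[symmetric] flip: powr_numeral)
    ultimately have "(d / a)\<^sup>2 * (a / d) powr (2 * \<kappa>) = (d / a) powr (2 - 2 * \<kappa>)" by simp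
    moreover have "p\<^sup>2 * t = (N / c)\<^sup>2 * exp c' * ((d / a)\<^sup>2 * (a / d) powr (2 * \<kappa>))"
      unfolding p_def t_def by (simp add: power_divide power_mult_distrib)
    ultimately show ?thesis by simp
  qed
  \<comment> \<open>Dividing by d trades one of the 2 - 2\<kappa> powers of d/a for 1/a, which
    produces the exponent in \<delta>.\<close>
  have p2t_d: "p\<^sup>2 * t / d = (N / c)\<^sup>2 * exp c' * (d / a) powr (1 - 2 * \<kappa>) / a"
  proof -
    have "(d / a) powr (2 - 2 * \<kappa>) = (d / a) powr (1 - 2 * \<kappa>) * (d / a)"
      using pos powr_add[of "d / a" "1 - 2 * \<kappa>" 1] by simp
    then show ?thesis unfolding p2t using pos by simp
  qed
  have eps1: "(d / a) powr (1 - 2 * \<kappa>) \<le> 1" using pos by (intro powr_le1) auto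
  have \<delta>: "(d / a) powr (1 - 2 * \<kappa>) / a * (1 + \<bar>\<eta>\<bar> * a) \<le> \<delta>" "1 / a \<le> \<delta>" "0 \<le> \<delta>"
  proof -
    have "(d / a) powr (1 - 2 * \<kappa>) / a * (1 + \<bar>\<eta>\<bar> * a)
        = (d / a) powr (1 - 2 * \<kappa>) / a + (d / a) powr (1 - 2 * \<kappa>) * \<bar>\<eta>\<bar>"
      using pos by (simp add: field_simps)
    moreover have "(d / a) powr (1 - 2 * \<kappa>) / a \<le> 1 / a" using eps1 pos by (intro divide_right_mono) auto
    ultimately show "(d / a) powr (1 - 2 * \<kappa>) / a * (1 + \<bar>\<eta>\<bar> * a) \<le> \<delta>" by (simp add: \<delta>_def \<eta>_def)
    show "1 / a \<le> \<delta>" by (simp add: \<delta>_def)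
    then show "0 \<le> \<delta>" using pos by (smt (verit) divide_nonneg_pos)
  qed

  have e_sq: "\<bar>(V z - U z)\<^sup>2\<bar> \<le> (2 * \<theta>\<^sup>2 + 4) * (1 + \<bar>\<eta>\<bar> * a) / d * t ^ l1 z" if z: "z \<in> D0" "z \<noteq> 0" for z
  proof -
    have "\<bar>Z z\<bar> \<le> sqrt (1 - v z * v (- z))
          * ((a / d) powr (\<kappa> * lnorm z) * sqrt (max 1 (\<bar>\<eta>\<bar> * a)))"
      using E3[of "x0 + z"] Qmono[OF z(1)] z(2) by (simp add: Z_def Qbox_at_def \<eta>_def)
    then have "\<bar>Z z\<bar>\<^sup>2 \<le> (sqrt (1 - v z * v (- z))
          * ((a / d) powr (\<kappa> * lnorm z) * sqrt (max 1 (\<bar>\<eta>\<bar> * a))))\<^sup>2"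
      by (intro power_mono) auto
    \<comment> \<open>Write 1 - v(z) v(-z) as (1 - v(z)) + v(z) (1 - v(-z)); each summand obeys the
      lower bound on v, hence the factor 2.\<close>
    moreover have vv: "1 - v z * v (- z) \<le> 2 * (exp (c' * lnorm z) / d)" "0 \<le> 1 - v z * v (- z)"
    proof -
      have nz: "- z \<noteq> 0" using z by simp
      have "lnorm (- z) = lnorm z" by (simp add: lnorm_def)
      then have "1 - v (- z) \<le> exp (c' * lnorm z) / d" using w0(2)[OF nz] by simp
      moreover have "v z * (1 - v (- z)) \<le> 1 * (1 - v (- z))"
        using w0[OF z(2)] w0[OF nz] by (intro mult_right_mono) auto
      ultimately show "1 - v z * v (- z) \<le> 2 * (exp (c' * lnorm z) / d)"
        using w0(2)[OF z(2)] by (simp add: algebra_simps)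
      have "v z * v (- z) \<le> 1 * 1" using w0[OF z(2)] w0[OF nz] v_nonneg by (intro mult_mono) auto
      then show "0 \<le> 1 - v z * v (- z)" by simp
    qed
    moreover have "((a / d) powr (\<kappa> * lnorm z))\<^sup>2 = (a / d) powr (2 * \<kappa> * lnorm z)"
      using pos by (simp add: powr_power mult_ac)
    ultimately have "(Z z)\<^sup>2 \<le> (1 - v z * v (- z)) * ((a / d) powr (2 * \<kappa> * lnorm z) * max 1 (\<bar>\<eta>\<bar> * a))"
      by (simp add: power_mult_distrib)
    also have "\<dots> \<le> (2 * (exp (c' * lnorm z) / d)) * ((a / d) powr (2 * \<kappa> * lnorm z) * (1 + \<bar>\<eta>\<bar> * a))"
      using vv pos by (intro mult_mono) auto
    also have "\<dots> = 2 / d * (1 + \<bar>\<eta>\<bar> * a) * (exp (c' * lnorm z) * (a / d) powr (2 * \<kappa> * lnorm z))" by simp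
    also have "\<dots> \<le> 2 / d * (1 + \<bar>\<eta>\<bar> * a) * t ^ l1 z"
      using expt pos by (intro mult_left_mono) auto
    finally have Zsq: "(Z z)\<^sup>2 \<le> 2 / d * (1 + \<bar>\<eta>\<bar> * a) * t ^ l1 z" .
    \<comment> \<open>One of the two factors 1 - v is bounded by 1 only, so that this term has the
      prefactor 1/d and the growth rate t of the fluctuation term.\<close>
    have "(1 - v z)\<^sup>2 \<le> 1 - v z"
      using mult_left_mono[OF w0(3)[OF z(2)] w0(4)[OF z(2)]] by (simp add: power2_eq_square)
    moreover have "\<eta>\<^sup>2 \<le> \<theta>\<^sup>2" using E1 pos by (simp add: \<eta>_def abs_le_square_iff[symmetric])
    ultimately have "(\<eta> * (1 - v z))\<^sup>2 \<le> \<theta>\<^sup>2 * (1 - v z)"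
      unfolding power_mult_distrib by (intro mult_mono) auto
    also have "\<dots> \<le> \<theta>\<^sup>2 * (t ^ l1 z / d)"
      using order_trans[OF w0(2)[OF z(2)] divide_right_mono[OF expt1[of z], of d]] pos
      by (intro mult_left_mono) auto
    also have "\<dots> \<le> \<theta>\<^sup>2 * (t ^ l1 z / d) * (1 + \<bar>\<eta>\<bar> * a)"
      using mult_left_mono[of 1 "1 + \<bar>\<eta>\<bar> * a" "\<theta>\<^sup>2 * (t ^ l1 z / d)"] pos t0 by simp
    finally have 2: "(\<eta> * (1 - v z))\<^sup>2 \<le> \<theta>\<^sup>2 * (t ^ l1 z / d) * (1 + \<bar>\<eta>\<bar> * a)" .
    have "(V z - U z)\<^sup>2 \<le> 2 * (Z z)\<^sup>2 + 2 * (\<eta> * (1 - v z))\<^sup>2"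
      unfolding VU using zero_le_power2[of "Z z + \<eta> * (1 - v z)"] by (simp add: power2_diff power2_sum)
    also have "\<dots> \<le> 2 * (2 / d * (1 + \<bar>\<eta>\<bar> * a) * t ^ l1 z) + 2 * (\<theta>\<^sup>2 * (t ^ l1 z / d) * (1 + \<bar>\<eta>\<bar> * a))"
      using Zsq 2 by linarith
    also have "\<dots> = (2 * \<theta>\<^sup>2 + 4) * (1 + \<bar>\<eta>\<bar> * a) / d * t ^ l1 z"
      using pos by (simp add: field_simps)
    finally show ?thesis by simp
  qed

  define P where "P = (\<Sum>z\<in>D0. (phib z)\<^sup>2 * (V z - U z)\<^sup>2) + 16 * N ^ 3 / a"
  have P_le: "P \<le> C2 * \<delta>"
  proof -
    let ?B = "(2 * \<theta>\<^sup>2 + 4) * (1 + \<bar>\<eta>\<bar> * a) / d"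
    have "\<bar>\<Sum>z\<in>D0. (phib z)\<^sup>2 * (V z - U z)\<^sup>2\<bar> \<le> ?B * (4 * N * (p\<^sup>2 * t))"
      unfolding N_def
    proof (rule weighted_sum_le[OF finD(2) p0 less_imp_le[OF t0] _ decay e_sq])
      show "0 \<le> ?B" using pos by simp
      show "2 * real (card (nbhd0 :: (int^'d) set)) * (p\<^sup>2 * t) \<le> 1" using s4 unfolding p2t N_def by simp
    qed (simp_all add: V0)
    also have "\<dots> = (2 * \<theta>\<^sup>2 + 4) * 4 * N * (1 + \<bar>\<eta>\<bar> * a) * (p\<^sup>2 * t / d)" by simp
    also have "\<dots> = (2 * \<theta>\<^sup>2 + 4) * 4 * N ^ 3 * exp c' / c\<^sup>2 * ((d / a) powr (1 - 2 * \<kappa>) / a * (1 + \<bar>\<eta>\<bar> * a))"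
      unfolding p2t_d by (simp add: power_divide power2_eq_square power3_eq_cube mult_ac)
    also have "\<dots> \<le> (2 * \<theta>\<^sup>2 + 4) * 4 * N ^ 3 * exp c' / c\<^sup>2 * \<delta>"
      using \<delta>(1) Npos by (intro mult_left_mono) auto
    finally have "(\<Sum>z\<in>D0. (phib z)\<^sup>2 * (V z - U z)\<^sup>2) \<le> (2 * \<theta>\<^sup>2 + 4) * 4 * N ^ 3 * exp c' / c\<^sup>2 * \<delta>" by linarith
    moreover have "16 * N ^ 3 / a \<le> 16 * N ^ 3 * \<delta>"
      using mult_left_mono[OF \<delta>(2), of "16 * N ^ 3"] Npos by simp
    ultimately show ?thesis by (simp add: P_def C2_def distrib_right)
  qed

  have far: "a / 2 < real (l1 z)" if "z \<in> D - D0" for z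
    using l1_gt_of_notin_Qbox[of z r] that ar by (auto simp: D0_def)
  define lam where "lam = princ_eigval (Qbox R) \<xi> - \<xi> x0"
  have lam: "- N \<le> lam" using princ_eigval_lower[OF finite_Qbox x0R, of \<xi>] by (simp add: lam_def N_def)
  \<comment> \<open>Stated for any unit eigenvector: the eigenvalue estimate uses the variational
    maximiser, whose sign is not known, and the eigenfunction estimate uses the given
    \<phi>.\<close>
  have bounds: "1 - (ip (Qbox R) u (\<lambda>x. phib (x - x0)))\<^sup>2 \<le> 9 * P / G\<^sup>2"
     "\<bar>lam - princ_eigval D0 U - (\<Sum>z\<in>D0. (phib z)\<^sup>2 * (V z - U z))\<bar> \<le> 6 * P / G"
    if u: "ip (Qbox R) u u = 1" "\<forall>x\<in>Qbox R. kapp (dker \<xi>) (Qbox R) u x = princ_eigval (Qbox R) \<xi> * u x" for u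
  proof -
    let ?u = "\<lambda>z. u (x0 + z)"
    have u1: "ip D ?u ?u = 1" using u(1) ip_translate[of "Qbox R" u u x0] by (simp add: D_def)
    have u2: "kapp (dker V) D ?u z = lam * ?u z" if "z \<in> D" for z
    proof -
      have "kapp (dker V) D ?u z = kapp (dker (\<lambda>z. \<xi> (x0 + z))) D ?u z - \<xi> x0 * ?u z"
        unfolding V_def by (rule kapp_dker_shift[OF finD(1) that])
      also have "kapp (dker (\<lambda>z. \<xi> (x0 + z))) D ?u z = kapp (dker \<xi>) (Qbox R) u (x0 + z)"
        unfolding D_def by (rule kapp_dker_translate[symmetric])
      finally show ?thesis using u(2) that by (simp add: D_iff lam_def algebra_simps)
    qed
    note b = local_trial_function_bounds[OF finD(1) sub zero V0 V_le G4[unfolded N_def] U_le m _ f far pos(2) u1 u2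
        lam[unfolded N_def], folded N_def, folded P_def]
    have s3': "4 * N * (N / m)\<^sup>2 \<le> 1" using s3 by (simp add: m_def)
    have "ip (Qbox R) u (\<lambda>x. phib (x - x0)) = ip D ?u phib"
      using ip_translate[of "Qbox R" u "\<lambda>x. phib (x - x0)" x0] by (simp add: D_def)
    then show "1 - (ip (Qbox R) u (\<lambda>x. phib (x - x0)))\<^sup>2 \<le> 9 * P / G\<^sup>2" using b(1) s3' by simp
    show "\<bar>lam - princ_eigval D0 U - (\<Sum>z\<in>D0. (phib z)\<^sup>2 * (V z - U z))\<bar> \<le> 6 * P / G"
      using b(2) s3' by simp
  qed
  have Ginv: "1 / G = 5 / (4 * c) * (d / a)" using pos by (simp add: G_def m_def)

  show "\<bar>princ_eigval (Qbox R) \<xi> - princ_eigval (Qbox r) (\<lambda>x. - Sfun a v x) - Xi r phib v \<xi> x0\<bar>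
      \<le> (15 * C2 / (2 * c) + C3) * (d / a) * \<delta>"
  proof -
    obtain u where "ip (Qbox R) u u = 1" "\<forall>x\<in>Qbox R. kapp (dker \<xi>) (Qbox R) u x = princ_eigval (Qbox R) \<xi> * u x"
      using princ_eigval_top(1)[OF finite_Qbox, of R \<xi>] x0R by blast
    then have 1: "\<bar>lam - princ_eigval D0 U - (\<Sum>z\<in>D0. (phib z)\<^sup>2 * (V z - U z))\<bar> \<le> 6 * P / G"
      using bounds(2) by blast
    have "6 * P / G = 6 * P * (1 / G)" by simp
    also have "\<dots> = 15 / (2 * c) * (d / a) * P" unfolding Ginv by (simp add: mult_ac)
    also have "\<dots> \<le> 15 / (2 * c) * (d / a) * (C2 * \<delta>)" using P_le pos by (intro mult_left_mono) auto
    finally have 2: "6 * P / G \<le> 15 * C2 / (2 * c) * (d / a) * \<delta>" by (simp add: mult_ac)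
    \<comment> \<open>The height deviation contributes at first order, so here the growth rate must
      be \<open>exp c'\<close> alone: using t would lose the factor (a/d)^(2\<kappa>) and miss the
      required order (d/a)(1/a).\<close>
    let ?W = "\<Sum>z\<in>D0. (phib z)\<^sup>2 * (1 - v z)"
    have "\<bar>?W\<bar> \<le> 1 / d * (4 * N * (p\<^sup>2 * exp c'))"
      unfolding N_def
    proof (rule weighted_sum_le[OF finD(2) p0 _ _ decay])
      fix z assume z: "z \<in> D0" "z \<noteq> 0"
      have "\<bar>1 - v z\<bar> \<le> exp (c' * lnorm z) / d" using w0[OF z(2)] by simp
      also have "exp (c' * lnorm z) \<le> exp c' ^ l1 z"
        using exp_powr_lnorm_le[of 1 0 c' z] pos by simp
      finally show "\<bar>1 - v z\<bar> \<le> 1 / d * exp c' ^ l1 z" using pos by (simp add: divide_right_mono)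
    next
      have "exp c' \<le> t" using mult_left_mono[of 1 "(a / d) powr (2 * \<kappa>)" "exp c'"] pos ad1
        by (simp add: t_def ge_one_powr_ge_zero)
      then have "2 * N * (p\<^sup>2 * exp c') \<le> 2 * N * (p\<^sup>2 * t)" using Npos by (intro mult_left_mono) auto
      also have "\<dots> \<le> 1" using s4 unfolding p2t .
      finally show "2 * real (card (nbhd0 :: (int^'d) set)) * (p\<^sup>2 * exp c') \<le> 1" by (simp add: N_def)
    qed (use pos v0 in auto)
    then have "\<bar>\<eta> * ?W\<bar> \<le> \<theta> * (1 / d * (4 * N * (p\<^sup>2 * exp c')))"
      unfolding abs_mult using E1 pos by (intro mult_mono) (auto simp: \<eta>_def)
    also have "\<dots> = C3 * (d / a) * (1 / a)"
      using pos by (simp add: p_def C3_def power2_eq_square power3_eq_cube mult_ac)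
    also have "\<dots> \<le> C3 * (d / a) * \<delta>"
      using \<delta>(2) pos Npos by (intro mult_left_mono) (auto simp: C3_def)
    finally have 3: "\<bar>\<eta> * ?W\<bar> \<le> C3 * (d / a) * \<delta>" .
    have "(\<Sum>z\<in>D0. (phib z)\<^sup>2 * (V z - U z)) = (\<Sum>z\<in>D0. (phib z)\<^sup>2 * Z z) - \<eta> * ?W"
      unfolding VU by (simp add: sum_distrib_left sum_subtractf[symmetric] algebra_simps)
    also have "(\<Sum>z\<in>D0. (phib z)\<^sup>2 * Z z) = Phi r phib v \<xi> x0"
      using sum.remove[OF finD(2) zero, of "\<lambda>z. (phib z)\<^sup>2 * Z z"] Z0
      by (simp add: Phi_def Z_def D0_def add.commute)
    finally have "princ_eigval (Qbox R) \<xi> - princ_eigval (Qbox r) (\<lambda>x. - Sfun a v x) - Xi r phib v \<xi> x0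
        = (lam - princ_eigval D0 U - (\<Sum>z\<in>D0. (phib z)\<^sup>2 * (V z - U z))) - \<eta> * ?W"
      by (simp add: lam_def Xi_def D0_def U_def)
    then show ?thesis using 1 2 3 unfolding distrib_right by linarith
  qed

  assume phi: "is_princ_efun (Qbox R) \<xi> \<phi>"
  show "sqrt (\<Sum>x\<in>Qbox R. (\<phi> x - phib (x - x0))\<^sup>2) \<le> sqrt (30 * C2) / c * (d / a) * sqrt \<delta>"
  proof -
    let ?\<psi> = "\<lambda>x. phib (x - x0)"
    define \<alpha> where "\<alpha> = ip (Qbox R) \<phi> ?\<psi>"
    have phi1: "ip (Qbox R) \<phi> \<phi> = 1" using phi by (rule princ_efun_unit)
    have "ip (Qbox R) ?\<psi> ?\<psi> = ip D phib phib" using ip_translate[of "Qbox R" ?\<psi> ?\<psi> x0] by (simp add: D_def)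
    also have "\<dots> = ip D0 phib phib"
      unfolding ip_def using finD sub princ_efun_outside[OF f] by (intro sum.mono_neutral_right) auto
    finally have psi1: "ip (Qbox R) ?\<psi> ?\<psi> = 1" using princ_efun_unit[OF f] by simp
    \<comment> \<open>Nonnegativity of both eigenfunctions selects the sign. It gives \<alpha>^2
      \<le> \<alpha>, which turns the squared distance 2 - 2\<alpha> into the overlap
      defect.\<close>
    have "0 \<le> \<alpha>" unfolding \<alpha>_def ip_def using phi phib by (intro sum_nonneg) (simp add: is_princ_efun_def)
    moreover have "\<alpha>\<^sup>2 \<le> 1" using ip_Cauchy_Schwarz[of "Qbox R" \<phi> ?\<psi>] phi1 psi1 by (simp add: \<alpha>_def)
    ultimately have "\<alpha>\<^sup>2 \<le> \<alpha>" by (metis abs_of_nonneg abs_square_le_1 mult_left_le power2_eq_square)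
    have "(\<Sum>x\<in>Qbox R. (\<phi> x - ?\<psi> x)\<^sup>2) = ip (Qbox R) (\<lambda>x. \<phi> x - ?\<psi> x) (\<lambda>x. \<phi> x - ?\<psi> x)"
      by (simp add: ip_def power2_eq_square)
    also have "\<dots> = 2 - 2 * \<alpha>"
      unfolding ip_linear using phi1 psi1 by (simp add: \<alpha>_def ip_commute[of _ ?\<psi> \<phi>])
    also have "\<dots> \<le> 2 * (1 - \<alpha>\<^sup>2)" using \<open>\<alpha>\<^sup>2 \<le> \<alpha>\<close> by simp
    also have "\<dots> \<le> 2 * (9 * P / G\<^sup>2)"
      using bounds(1)[of \<phi>] phi1 princ_efun_eigen[OF finite_Qbox phi] by (simp add: \<alpha>_def)
    also have "\<dots> = 18 * P * (1 / G)\<^sup>2" by (simp add: power_divide)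
    also have "\<dots> \<le> 18 * (C2 * \<delta>) * (1 / G)\<^sup>2" using P_le by (intro mult_right_mono mult_left_mono) auto
    also have "\<dots> = (225 / 8) * (C2 * \<delta>) * (1 / c * (d / a))\<^sup>2" unfolding Ginv by (simp add: power2_eq_square mult_ac)
    \<comment> \<open>The constant 225/8 = 18 (5/4)^2 is rounded up to 30.\<close>
    also have "\<dots> \<le> 30 * (C2 * \<delta>) * (1 / c * (d / a))\<^sup>2"
      using \<delta>(3) Npos by (intro mult_right_mono) (auto simp: C2_def)
    also have "\<dots> = 30 * C2 * \<delta> * (1 / c * (d / a))\<^sup>2" by simp
    finally have "sqrt (\<Sum>x\<in>Qbox R. (\<phi> x - ?\<psi> x)\<^sup>2) \<le> sqrt (30 * C2 * \<delta> * (1 / c * (d / a))\<^sup>2)"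
      by (rule real_sqrt_le_mono)
    also have "\<dots> = sqrt (30 * C2) * sqrt \<delta> * (1 / c * (d / a))"
      using pos by (simp only: real_sqrt_mult real_sqrt_abs) simp
    finally show ?thesis by (simp add: mult_ac)
  qed
qed

section \<open>Gaussian fields\<close>

text \<open>A field is specified by characteristic functions only, so laws, and from them moments,
  have to be recovered by Levy's uniqueness theorem.\<close>

lemma gaussian_combination_std_normal:
  assumes gf: "centred_gaussian_field M X K" and fin: "finite S" and \<sigma>: "0 < \<sigma>"
    and cov: "(\<Sum>x\<in>S. \<Sum>y\<in>S. c x * c y * K x y) = \<sigma>\<^sup>2"
  shows "distr M borel (\<lambda>\<omega>. (\<Sum>x\<in>S. c x * X \<omega> x) / \<sigma>) = std_normal_distribution"
proof -
  let ?Z = "\<lambda>\<omega>. (\<Sum>x\<in>S. c x * X \<omega> x) / \<sigma>"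
  interpret prob_space M using gf by (simp add: centred_gaussian_field_def)
  have [measurable]: "(\<lambda>\<omega>. X \<omega> x) \<in> borel_measurable M" for x
    using gf by (simp add: centred_gaussian_field_def)
  have Z[measurable]: "?Z \<in> borel_measurable M" by measurable
  have "char (distr M borel ?Z) t = char std_normal_distribution t" for t
  proof -
    have "char (distr M borel ?Z) t = integral\<^sup>L M (\<lambda>\<omega>. cis (t / \<sigma> * (\<Sum>x\<in>S. c x * X \<omega> x)))"
      unfolding char_def by (subst integral_distr) (auto simp: cis_conv_exp mult_ac)
    also have "\<dots> = complex_of_real (exp (- ((t / \<sigma>)\<^sup>2 / 2) * \<sigma>\<^sup>2))"
      using gf fin unfolding centred_gaussian_field_def cov[symmetric] by blast
    also have "- ((t / \<sigma>)\<^sup>2 / 2) * \<sigma>\<^sup>2 = - (t\<^sup>2) / 2"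
      using \<sigma> by (simp add: power_divide)
    finally show ?thesis by (simp add: char_std_normal_distribution)
  qed
  then show ?thesis
    by (intro Levy_uniqueness real_distribution_distr Z real_dist_normal_dist ext)
qed

lemma gaussian_combination_var:
  assumes gf: "centred_gaussian_field M X K" and fin: "finite S" and \<sigma>: "0 < \<sigma>"
    and cov: "(\<Sum>x\<in>S. \<Sum>y\<in>S. c x * c y * K x y) = \<sigma>\<^sup>2"
  shows "var M (\<lambda>\<omega>. \<Sum>x\<in>S. c x * X \<omega> x) = \<sigma>\<^sup>2"
proof -
  let ?Y = "\<lambda>\<omega>. \<Sum>x\<in>S. c x * X \<omega> x"
  let ?Z = "\<lambda>\<omega>. ?Y \<omega> / \<sigma>"
  interpret prob_space M using gf by (simp add: centred_gaussian_field_def)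
  have [measurable]: "(\<lambda>\<omega>. X \<omega> x) \<in> borel_measurable M" for x
    using gf by (simp add: centred_gaussian_field_def)
  have Z[measurable]: "?Z \<in> borel_measurable M" by measurable
  have "distr M lborel ?Z = distr M borel ?Z" by (rule distr_cong) auto
  then have D: "distributed M lborel ?Z std_normal_density"
    using gaussian_combination_std_normal[OF assms] by (simp add: distributed_def)
  then have E: "expectation ?Z = 0" by (rule standard_normal_distributed_expectation)
  have V: "variance ?Z = 1" using normal_distributed_variance[OF zero_less_one D] by (simp only: power_one)
  have "expectation ?Y = 0" using E \<sigma> by simp
  then have "var M ?Y = expectation (\<lambda>\<omega>. \<sigma>\<^sup>2 * (?Z \<omega>)\<^sup>2)"
    unfolding var_def using \<sigma> by (simp add: power_divide)
  also have "\<dots> = \<sigma>\<^sup>2 * expectation (\<lambda>\<omega>. (?Z \<omega>)\<^sup>2)" by (rule integral_mult_right_zero)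
  also have "expectation (\<lambda>\<omega>. (?Z \<omega>)\<^sup>2) = 1" using V unfolding E diff_zero .
  finally show ?thesis by simp
qed

text \<open>
  The hypotheses on the field only determine the symmetrisation of \<open>v\<close>, so \<open>v (- z) = v z\<close> is not available.
\<close>

lemma var_zeta:
  fixes v :: "int^'d \<Rightarrow> real"
  assumes gf: "centred_gaussian_field M X (\<lambda>x y. v (x - y))" and v0: "v 0 = 1"
    and x: "x \<noteq> x0" and pos: "v (x - x0) * v (x0 - x) < 1"
  shows "var M (\<lambda>\<omega>. zeta v (X \<omega>) x0 x) = 1 - v (x - x0) * v (x0 - x)"
proof -
  let ?c = "\<lambda>y. if y = x then 1 else - v (x - x0)"
  let ?s = "sqrt (1 - v (x - x0) * v (x0 - x))"
  \<comment> \<open>With the coefficient \<open>- v (x - x0)\<close> at \<open>x0\<close>, the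
    diagonal term at \<open>x0\<close> cancels one of the two mixed terms and the other one
    survives.\<close>
  have "(\<Sum>y\<in>{x, x0}. \<Sum>z\<in>{x, x0}. ?c y * ?c z * v (y - z)) = ?s\<^sup>2"
    using x v0 pos by (auto simp: algebra_simps power2_eq_square)
  then have "var M (\<lambda>\<omega>. \<Sum>y\<in>{x, x0}. ?c y * X \<omega> y) = ?s\<^sup>2"
    using gaussian_combination_var[OF gf, of "{x, x0}" ?s ?c] pos by simp
  moreover have "(\<lambda>\<omega>. \<Sum>y\<in>{x, x0}. ?c y * X \<omega> y) = (\<lambda>\<omega>. zeta v (X \<omega>) x0 x)"
    using x by (auto simp: zeta_def)
  ultimately show ?thesis using pos by simp
qed

lemma std_normal_positive_tail: "0 < measure std_normal_distribution {0::real<..}"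
proof -
  have 1: "finite_measure std_normal_distribution"
    using real_dist_normal_dist by (simp add: real_distribution_def prob_space_def)
  have "emeasure std_normal_distribution {0::real<..} \<noteq> 0"
  proof
    assume "emeasure std_normal_distribution {0::real<..} = 0"
    then have "{0::real<..} \<in> null_sets (density lborel std_normal_density)"
      by (simp add: null_sets_def)
    then have "AE x in lborel. x \<in> {0::real<..} \<longrightarrow> ennreal (std_normal_density x) = 0"
      by (subst (asm) null_sets_density_iff) auto
    then have "AE x in lborel. x \<notin> {0::real<..}"
      by eventually_elim (use normal_density_pos[of 1 0] in \<open>auto simp: less_le\<close>)
    then have "emeasure lborel {0::real<..} = 0"
      by (subst AE_iff_measurable[of "{0::real<..}", symmetric]) auto
    moreover have "emeasure lborel {0::real<..<1} \<le> emeasure lborel {0::real<..}"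
      by (rule emeasure_mono) auto
    ultimately show False by simp
  qed
  then show ?thesis
    using finite_measure.emeasure_eq_measure[OF 1, of "{0::real<..}"]
    by (metis ennreal_0 measure_nonneg order_le_less)
qed

text \<open>A nonpositive level is exceeded with probability bounded below by a positive constant.
  This is incompatible with the defining probability L^(-d) for large L and so forces a_L >
  0.\<close>

lemma gaussian_tail_ge:
  assumes gf: "centred_gaussian_field M X K" and K: "K x x = 1" and a: "a \<le> 0"
  shows "measure std_normal_distribution {0<..} \<le> measure M {\<omega>\<in>space M. X \<omega> x > a}"
proof -
  interpret prob_space M using gf by (simp add: centred_gaussian_field_def)
  have [measurable]: "(\<lambda>\<omega>. X \<omega> x) \<in> borel_measurable M"
    using gf by (simp add: centred_gaussian_field_def)
  have "distr M borel (\<lambda>\<omega>. X \<omega> x) = std_normal_distribution"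
    using gaussian_combination_std_normal[OF gf, of "{x}" 1 "\<lambda>_. 1"] K by simp
  then have "measure std_normal_distribution {0<..} = measure (distr M borel (\<lambda>\<omega>. X \<omega> x)) {0<..}" by simp
  also have "\<dots> = measure M ((\<lambda>\<omega>. X \<omega> x) -` {0<..} \<inter> space M)"
    by (rule measure_distr) auto
  also have "\<dots> \<le> measure M {\<omega>\<in>space M. X \<omega> x > a}"
    using a by (intro finite_measure_mono) auto
  finally show ?thesis .
qed

text \<open>The upper bound on \<open>vL\<close> makes the nearest-neighbour supremum finite and
  strictly below 1, and nonnegativity makes it at least 0, so \<open>dL vL\<close> is the reciprocal
  of a number in (0, 1].\<close>

lemma dL_ge_1:
  fixes vL :: "int^'d \<Rightarrow> real"
  assumes nonneg: "\<And>x. 0 \<le> vL x" and c: "0 < c" and d: "0 < dL vL"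
    and up: "\<And>x. x \<noteq> 0 \<Longrightarrow> vL x \<le> 1 - c / dL vL"
  shows "1 \<le> dL vL"
proof -
  let ?s = "SUP x\<in>{x. lnorm x = 1}. vL x"
  have ne: "{x :: int^'d. lnorm x = 1} \<noteq> {}" using nbhd0_nonempty by (simp add: nbhd0_def)
  then obtain z :: "int^'d" where z: "lnorm z = 1" by auto
  have le: "vL x \<le> 1 - c / dL vL" if "lnorm x = 1" for x using that by (intro up) auto
  have "bdd_above (vL ` {x. lnorm x = 1})" using le by (auto intro!: bdd_aboveI)
  then have "vL z \<le> ?s" using z by (intro cSUP_upper) auto
  moreover have "?s \<le> 1 - c / dL vL" using le ne by (intro cSUP_least) auto
  ultimately have "0 < 1 - ?s" "1 - ?s \<le> 1" using nonneg[of z] divide_pos_pos[OF c d] by linarith+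
  then show ?thesis by (simp add: dL_def)
qed

section \<open>From the asymptotic hypotheses to a fixed scale\<close>

lemma lnorm_unbounded: "\<exists>x :: int^'d. x \<noteq> 0 \<and> B \<le> lnorm x"
proof -
  let ?x = "\<chi> i. max 1 \<lceil>B\<rceil> :: int^'d"
  obtain i :: 'd where True by simp
  have "\<bar>real_of_int (?x $ i)\<bar> \<le> lnorm ?x" by (rule abs_component_le_lnorm)
  then have "B \<le> lnorm ?x" by simp linarith
  moreover have "?x \<noteq> 0" by (auto simp: vec_eq_iff)
  ultimately show ?thesis by blast
qed

theorem theorem4p2:
  fixes M :: "nat \<Rightarrow> 'w measure"
    and X :: "nat \<Rightarrow> 'w \<Rightarrow> int^'d \<Rightarrow> real"
    and v :: "nat \<Rightarrow> int^'d \<Rightarrow> real"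
    and a R r :: "nat \<Rightarrow> real"
    and phibar :: "nat \<Rightarrow> int^'d \<Rightarrow> real"
    and \<kappa> :: real
  assumes kappa: "0 < \<kappa>" "\<kappa> < 1/3"
    and field: "\<forall>L\<ge>1. centred_gaussian_field (M L) (X L) (\<lambda>x y. v L (x - y))"
    and unit_var: "\<forall>L\<ge>1. v L 0 = 1"
    and cov_nonneg: "\<forall>L\<ge>1. \<forall>x. 0 \<le> v L x"
    and hypI: "\<forall>\<epsilon>>0. \<exists>L1. \<forall>L\<ge>L1. \<forall>x. exp (sqrt (ln (real L))) \<le> lnorm x
                  \<longrightarrow> v L x * ln (lnorm x) \<le> \<epsilon>"
    and hypII: "\<exists>c c'. 0 < c \<and> 0 < c' \<and> (\<forall>L\<ge>1. \<forall>x. x \<noteq> 0 \<longrightarrow>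
                  1 - exp (c' * lnorm x) / dL (v L) \<le> v L x \<and> v L x \<le> 1 - c / dL (v L))"
    and a_def: "\<forall>L\<ge>2. measure (M L) {\<omega>\<in>space (M L). X L \<omega> 0 > a L} = 1 / real L ^ CARD('d)"
    and R_low: "(\<lambda>L. a L / ln (R L)) \<longlonglongrightarrow> 0"
    and R_up: "(\<lambda>L. ln (R L) / (a L ^ 2 / dL (v L))) \<longlonglongrightarrow> 0"
    and r_low: "\<forall>L\<ge>2. ln (a L) \<le> ln (r L)"
    and r_up: "(\<lambda>L. ln (r L) / sqrt (a L)) \<longlonglongrightarrow> 0"
    and phibar: "\<forall>L\<ge>2. is_princ_efun (Qbox (r L)) (\<lambda>x. - Sfun (a L) (v L) x) (phibar L)"
    and d_small: "(\<lambda>L. dL (v L) / a L) \<longlonglongrightarrow> 0"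
    and tau_small: "(\<lambda>L. sqrt (var (M L) (\<lambda>\<omega>. Phi (r L) (phibar L) (v L) (X L \<omega>) 0))
                      / (inverse (a L) * sqrt (a L / dL (v L)))) \<longlonglongrightarrow> 0"
  shows "\<exists>C>0. \<exists>L0::nat. 1 \<le> L0 \<and> (\<forall>L\<ge>L0. \<forall>x0\<in>Qbox (R L - r L). \<forall>\<omega>\<in>space (M L).
           in_event (M L) (X L) (v L) (a L) (R L) x0 \<kappa> \<omega> \<longrightarrow>
           (let \<delta> = (dL (v L) / a L) powr (1 - 2 * \<kappa>) * \<bar>X L \<omega> x0 - a L\<bar> + 1 / a L in
             \<bar>princ_eigval (Qbox (R L)) (X L \<omega>)
                - princ_eigval (Qbox (r L)) (\<lambda>x. - Sfun (a L) (v L) x)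
                - Xi (r L) (phibar L) (v L) (X L \<omega>) x0\<bar>
               \<le> C * (dL (v L) / a L) * \<delta>
             \<and> (\<forall>\<phi>. is_princ_efun (Qbox (R L)) (X L \<omega>) \<phi> \<longrightarrow>
                  sqrt (\<Sum>x\<in>Qbox (R L). (\<phi> x - phibar L (x - x0))^2)
                    \<le> C * (dL (v L) / a L) * sqrt \<delta>)))"
proof -
  obtain c c' where c: "0 < c" "0 < c'"
    and II: "\<And>L x. 1 \<le> L \<Longrightarrow> x \<noteq> 0 \<Longrightarrow> 1 - exp (c' * lnorm x) / dL (v L) \<le> v L x \<and> v L x \<le> 1 - c / dL (v L)"
    using hypII by blast
  define N where "N = real (card (nbhd0 :: (int^'d) set))"
  have N: "0 < N" unfolding N_def using card_nbhd0_pos by simp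
  define \<theta> where "\<theta> = real (2 * CARD('d) + 1)"
  have \<theta>: "0 < \<theta>" by (simp add: \<theta>_def)
  define C2 where "C2 = (2 * \<theta>\<^sup>2 + 4) * 4 * N ^ 3 * exp c' / c\<^sup>2 + 16 * N ^ 3"
  define C3 where "C3 = 4 * N ^ 3 * \<theta> * exp c' / c\<^sup>2"
  \<comment> \<open>A sum that dominates both the eigenvalue and the eigenfunction constant.\<close>
  define C where "C = 15 * C2 / (2 * c) + C3 + sqrt (30 * C2) / c"
  have C23: "0 < C2" "0 < C3" using N \<theta> c by (auto simp: C2_def C3_def intro!: add_nonneg_pos)
  then have C: "0 < C" "15 * C2 / (2 * c) + C3 \<le> C" "sqrt (30 * C2) / c \<le> C"
    using c by (auto simp: C_def intro!: add_pos_pos add_pos_nonneg)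

  have ev_d: "\<forall>\<^sub>F L in sequentially. 1 \<le> dL (v L)"
  proof -
    obtain L1 where L1: "\<And>L x. L1 \<le> L \<Longrightarrow> exp (sqrt (ln (real L))) \<le> lnorm x \<Longrightarrow> v L x * ln (lnorm x) \<le> 1"
      using hypI zero_less_one by blast
    show ?thesis
    proof (rule eventually_sequentiallyI[of "max 1 L1"])
      fix L assume L: "max 1 L1 \<le> L"
      \<comment> \<open>The site is far enough for (I) to apply with bound 1, and exp 2 makes its
        logarithm at least 2, so v \<ge> 1 there is contradictory.\<close>
      obtain x :: "int^'d" where x: "x \<noteq> 0" "max (exp (sqrt (ln (real L)))) (exp 2) \<le> lnorm x"
        using lnorm_unbounded by blast
      \<comment> \<open>A non-positive \<open>dL\<close> (including the junk value 0 for supremum 1) would force \<open>v \<ge> 1\<close>, against decay.\<close>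
      have "0 < dL (v L)"
      proof (rule ccontr)
        assume "\<not> 0 < dL (v L)"
        then have "exp (c' * lnorm x) / dL (v L) \<le> 0" by (intro divide_nonneg_nonpos) auto
        then have v1: "1 \<le> v L x" using II[of L x] L x(1) by fastforce
        have ln2: "2 \<le> ln (lnorm x)" using x(2) by (subst ln_ge_iff) (auto intro: less_le_trans[OF exp_gt_zero])
        then have "1 * 2 \<le> v L x * ln (lnorm x)" using v1 by (intro mult_mono) auto
        then show False using L1[of L x] L x(2) by simp
      qed
      then show "1 \<le> dL (v L)"
        using II[of L] cov_nonneg L c(1) by (intro dL_ge_1[of "v L" c]) auto
    qed
  qed

  \<comment> \<open>As \<open>a\<close> is given only implicitly through a tail probability, its
    sign is read off from that probability.\<close>
  have ev_a: "\<forall>\<^sub>F L in sequentially. 0 < a L"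
  proof -
    have "\<forall>\<^sub>F L in sequentially. 1 / real L < measure std_normal_distribution {0<..}"
      using order_tendstoD(2)[OF lim_1_over_n[where 'a = real] std_normal_positive_tail] by simp
    then show ?thesis using eventually_ge_at_top[of 2]
    proof eventually_elim
      case (elim L)
      have "measure (M L) {\<omega>\<in>space (M L). X L \<omega> 0 > a L} = 1 / real L ^ CARD('d)"
        using a_def elim by simp
      also have "\<dots> \<le> 1 / real L ^ 1" using elim by (intro divide_left_mono power_increasing) auto
      also have "\<dots> < measure std_normal_distribution {0<..}" using elim by simp
      finally have "\<not> measure std_normal_distribution {0<..} \<le> measure (M L) {\<omega>\<in>space (M L). X L \<omega> 0 > a L}"
        by simp
      moreover have "centred_gaussian_field (M L) (X L) (\<lambda>x y. v L (x - y))" "v L (0 - 0) = 1"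
        using field unit_var elim by auto
      ultimately show ?case using gaussian_tail_ge[of "M L" "X L" "\<lambda>x y. v L (x - y)" 0 "a L"] by linarith
    qed
  qed

  \<comment> \<open>The first entry gives d \<le> a, the others give \<open>s1\<close> to
    \<open>s4\<close> in this order. For \<open>s3\<close> and \<open>s4\<close> the powers 2 and 2
    - 2\<kappa> of d/a are bounded by d/a itself, as both exponents are at least 1.\<close>
  define e0 where "e0 = Min {1/2, c / (5 * N), 1 / (10 * \<theta>), 1 / (4 * N * (N / c)\<^sup>2), 1 / (2 * N * ((N / c)\<^sup>2 * exp c'))}"
  have e0: "0 < e0" unfolding e0_def using c N \<theta> by (subst Min_gr_iff) auto
  have e0_le: "e0 \<le> 1/2" "e0 \<le> c / (5 * N)" "e0 \<le> 1 / (10 * \<theta>)" "e0 \<le> 1 / (4 * N * (N / c)\<^sup>2)"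
    "e0 \<le> 1 / (2 * N * ((N / c)\<^sup>2 * exp c'))"
    unfolding e0_def by (rule Min_le; simp)+
  have "\<forall>\<^sub>F L in sequentially. dL (v L) / a L < e0" using d_small e0 by (rule order_tendstoD(2))
  with ev_d ev_a eventually_ge_at_top[of 2]
  have "\<forall>\<^sub>F L in sequentially. 1 \<le> dL (v L) \<and> 0 < a L \<and> dL (v L) / a L < e0 \<and> 2 \<le> L"
    by eventually_elim simp
  then obtain L0 where L0: "\<And>L. L0 \<le> L \<Longrightarrow> 1 \<le> dL (v L) \<and> 0 < a L \<and> dL (v L) / a L < e0 \<and> 2 \<le> L"
    by (auto simp: eventually_sequentially)

  have "let \<delta> = (dL (v L) / a L) powr (1 - 2 * \<kappa>) * \<bar>X L \<omega> x0 - a L\<bar> + 1 / a L in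
         \<bar>princ_eigval (Qbox (R L)) (X L \<omega>)
            - princ_eigval (Qbox (r L)) (\<lambda>x. - Sfun (a L) (v L) x)
            - Xi (r L) (phibar L) (v L) (X L \<omega>) x0\<bar>
           \<le> C * (dL (v L) / a L) * \<delta>
         \<and> (\<forall>\<phi>. is_princ_efun (Qbox (R L)) (X L \<omega>) \<phi> \<longrightarrow>
              sqrt (\<Sum>x\<in>Qbox (R L). (\<phi> x - phibar L (x - x0))^2)
                \<le> C * (dL (v L) / a L) * sqrt \<delta>)"
    if "max 1 L0 \<le> L" and x0: "x0 \<in> Qbox (R L - r L)"
      and ev: "in_event (M L) (X L) (v L) (a L) (R L) x0 \<kappa> \<omega>" for L x0 \<omega>
  proof -
    define d where "d = dL (v L)"
    have L: "1 \<le> d" "0 < a L" "d / a L < e0" "2 \<le> L" "1 \<le> L" using L0[of L] that by (auto simp: d_def)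
    have d0: "0 < d" using L by simp
    note f = field[rule_format, OF L(5)] and v0 = unit_var[rule_format, OF L(5)]
      and vn = cov_nonneg[rule_format, OF L(5)] and pb = phibar[rule_format, OF L(4)]
    have eps: "0 < d / a L" "d / a L \<le> 1" using d0 L e0_le(1) divide_pos_pos[OF d0 L(2)] by linarith+
    have "d / a L \<le> 1 / (10 * \<theta>)" using L e0_le by linarith
    then have "10 * \<theta> * d \<le> a L" using L \<theta> by (simp add: field_simps)
    \<comment> \<open>Here d \<ge> 1 turns smallness of the ratio d/a into largeness of a.\<close>
    moreover have "10 * \<theta> * 1 \<le> 10 * \<theta> * d" using L \<theta> by (intro mult_left_mono) auto
    ultimately have s2: "10 * \<theta> \<le> a L" by simp
    then have a1: "1 < a L" by (simp add: \<theta>_def)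
    have s1: "5 * N * d \<le> c * a L"
    proof -
      have "d / a L \<le> c / (5 * N)" using L e0_le by linarith
      then show ?thesis using L N by (simp add: field_simps)
    qed
    have s3: "4 * N * (N * d / (c * a L))\<^sup>2 \<le> 1"
    proof -
      have "4 * N * (N * d / (c * a L))\<^sup>2 = 4 * N * (N / c)\<^sup>2 * (d / a L)\<^sup>2"
        by (simp add: power_mult_distrib power_divide)
      also have "\<dots> \<le> 4 * N * (N / c)\<^sup>2 * (d / a L)"
        using eps N mult_left_le[of "d / a L" "d / a L"] by (intro mult_left_mono) (auto simp: power2_eq_square)
      also have "\<dots> \<le> 4 * N * (N / c)\<^sup>2 * (1 / (4 * N * (N / c)\<^sup>2))"
        using L e0_le N by (intro mult_left_mono) auto
      also have "\<dots> = 1" using N c by simp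
      finally show ?thesis .
    qed
    have s4: "2 * N * ((N / c)\<^sup>2 * exp c' * (d / a L) powr (2 - 2 * \<kappa>)) \<le> 1"
    proof -
      have "(d / a L) powr (2 - 2 * \<kappa>) \<le> (d / a L) powr 1" using eps kappa by (intro powr_mono') auto
      then have "(d / a L) powr (2 - 2 * \<kappa>) \<le> 1 / (2 * N * ((N / c)\<^sup>2 * exp c'))" using eps L e0_le by simp
      then have "2 * N * ((N / c)\<^sup>2 * exp c') * (d / a L) powr (2 - 2 * \<kappa>)
          \<le> 2 * N * ((N / c)\<^sup>2 * exp c') * (1 / (2 * N * ((N / c)\<^sup>2 * exp c')))"
        using N by (intro mult_left_mono) auto
      also have "\<dots> = 1" using N c by simp
      finally show ?thesis by (simp add: mult_ac)
    qed
    \<comment> \<open>The inequality between logarithms yields a \<le> r only for positive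
      arguments. An eigenfunction exists, so the box is nonempty and r \<ge> 0; and r = 0 is
      excluded because \<open>ln 0\<close> is 0 while ln a > 0.\<close>
    have "Qbox (r L) \<noteq> ({} :: (int^'d) set)" using princ_efun_nonempty[OF pb] .
    then have "0 \<le> r L" using Qbox_nonneg by blast
    moreover have lnr: "ln (a L) \<le> ln (r L)" using r_low L by simp
    moreover have "r L \<noteq> 0" using lnr ln_gt_zero[OF a1] by auto
    ultimately have ar: "a L \<le> r L" using L by simp
    have E1: "\<bar>X L \<omega> x0 - a L\<bar> \<le> \<theta>"
      and E2: "\<And>x. x \<in> Qbox_at (2 * R L) x0 \<Longrightarrow> \<bar>zeta (v L) (X L \<omega>) x0 x\<bar> \<le> Sfun (a L) (v L) (x - x0) / 10"
      using ev by (auto simp: in_event_def \<theta>_def)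
    have E3: "\<bar>zeta (v L) (X L \<omega>) x0 x\<bar> \<le> sqrt (1 - v L (x - x0) * v L (x0 - x))
          * ((a L / d) powr (\<kappa> * lnorm (x - x0)) * sqrt (max 1 (\<bar>X L \<omega> x0 - a L\<bar> * a L)))"
      if x: "x \<in> Qbox_at (R L) x0" "x \<noteq> x0" for x
    proof -
      \<comment> \<open>A positive variance is needed to clear the denominator in the third part of
        the event: with variance 0 the quotient would be 0 by convention and carry no
        information.\<close>
      have "v L z < 1" if "z \<noteq> 0" for z
        using II[OF L(5) that] divide_pos_pos[OF c(1) d0] by (simp add: d_def)
      then have "v L (x - x0) < 1" "v L (x0 - x) < 1" using x by auto
      then have vv: "v L (x - x0) * v L (x0 - x) < 1"
        using vn by (metis mult_left_le less_imp_le order_le_less_trans)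
      have "\<bar>zeta (v L) (X L \<omega>) x0 x\<bar> / sqrt (var (M L) (\<lambda>\<omega>'. zeta (v L) (X L \<omega>') x0 x))
          \<le> (a L / d) powr (\<kappa> * lnorm (x - x0)) * sqrt (max 1 (\<bar>X L \<omega> x0 - a L\<bar> * a L))"
        using ev x by (auto simp: in_event_def d_def)
      then show ?thesis
        unfolding var_zeta[OF f v0 x(2) vv] using vv by (simp add: pos_divide_le_eq mult_ac)
    qed
    have da: "d \<le> a L" using eps L by simp
    define \<delta> where "\<delta> = (d / a L) powr (1 - 2 * \<kappa>) * \<bar>X L \<omega> x0 - a L\<bar> + 1 / a L"
    have \<delta>: "0 \<le> \<delta>" using L by (simp add: \<delta>_def)
    note II' = II[OF L(5), folded d_def]
    note main = localisation_at_scale[OF d0 L(2) da c less_imp_le[OF \<theta>] kappa v0 vn conjunct1[OF II'] conjunct2[OF II'],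
        folded N_def, OF _ _ s1 s2 s3 s4 ar pb x0 E1 E2 E3, folded N_def, folded C2_def C3_def \<delta>_def]
    have "\<bar>princ_eigval (Qbox (R L)) (X L \<omega>)
            - princ_eigval (Qbox (r L)) (\<lambda>x. - Sfun (a L) (v L) x)
            - Xi (r L) (phibar L) (v L) (X L \<omega>) x0\<bar> \<le> (15 * C2 / (2 * c) + C3) * (d / a L) * \<delta>"
      by (rule main(1))
    also have "\<dots> \<le> C * (d / a L) * \<delta>" using C(2) eps \<delta> by (intro mult_right_mono) auto
    finally have 1: "\<bar>princ_eigval (Qbox (R L)) (X L \<omega>)
            - princ_eigval (Qbox (r L)) (\<lambda>x. - Sfun (a L) (v L) x)
            - Xi (r L) (phibar L) (v L) (X L \<omega>) x0\<bar> \<le> C * (d / a L) * \<delta>" .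
    have 2: "sqrt (\<Sum>x\<in>Qbox (R L). (\<phi> x - phibar L (x - x0))^2) \<le> C * (d / a L) * sqrt \<delta>"
      if "is_princ_efun (Qbox (R L)) (X L \<omega>) \<phi>" for \<phi>
    proof -
      have "sqrt (\<Sum>x\<in>Qbox (R L). (\<phi> x - phibar L (x - x0))^2) \<le> sqrt (30 * C2) / c * (d / a L) * sqrt \<delta>"
        by (rule main(2)[OF _ _ _ _ _ that])
      also have "\<dots> \<le> C * (d / a L) * sqrt \<delta>" using C(3) eps \<delta> by (intro mult_right_mono) auto
      finally show ?thesis .
    qed
    show ?thesis using 1 2 by (simp add: Let_def d_def \<delta>_def)
  qed
  then show ?thesis using C(1) by (intro exI[of _ C] conjI exI[of _ "max 1 L0"] allI ballI impI) auto
qed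

end
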